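(* Let $E$ and $S$ be Polish spaces, $c:E\times S\to\mathbb{R}\cup\{+\infty\}$ a non-negative lower semi-continuous map, $\eta\in\mathcal{P}_E$ and $\nu\in\mathcal{P}_S$. Let $h:E\times S\to\mathbb{R}$ be of the form $$h(x,y)=\sum_{i=1}^N Z_i(x)\,1_{A_i}(y)$$ for some $N\in\mathbb{N}$, where $Z_i\in\mathcal{L}^\infty(\eta)$ and $A_i\in\mathcal{B}(S)$ satisfies $\nu(\partial A_i)=0$ for all $i=1,\dots,N$. Define $$D^h_{\eta,\nu}:=\sup\left\{\int_E f\,d\eta+\int_S g\,d\nu\ :\ (f,g)\in\mathcal{L}^\infty(\eta)\times C_b(S),\ f(x)+g(y)\le c(x,y)+h(x,y)\ \ \forall (x,y)\in E\times S\right\}$$ and $$P^h_{\eta,\nu}:=\inf\left\{\int_{E\times S}\big(c(x,y)+h(x,y)\big)\,d\gamma(x,y)\ :\ \gamma\in\Pi(\eta,\nu)\right\}.$$ Then $P^h_{\eta,\nu}=D^h_{\eta,\nu}$.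
   Context: $\mathcal{P}_Z$ is the set of Borel probabilities on a Polish space $Z$. $\Pi(\eta,\nu)$ is the set of Borel probabilities on $E\times S$ with first marginal $\eta$ and second marginal $\nu$. $\mathcal{L}^\infty(\eta)$ denotes the set of genuine functions (not equivalence classes) $E\to\mathbb{R}$ that are measurable with respect to the $\eta$-completed Borel sigma-field and $\eta$-essentially bounded. $\partial A$ is the topological boundary of $A$. *)

theory Defs
  imports "HOL-Probability.Probability"
begin

definition borel_probs :: "('a::topological_space) measure set" where
  "borel_probs = {\<mu>. sets \<mu> = sets borel \<and> prob_space \<mu>}"

definition couplings ::
  "('e::topological_space) measure \<Rightarrow> ('s::topological_space) measure \<Rightarrow> ('e \<times> 's) measure set" where
  "couplings \<eta> \<nu> = {\<gamma> \<in> borel_probs. distr \<gamma> borel fst = \<eta> \<and> distr \<gamma> borel snd = \<nu>}"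

text \<open>Genuine functions, not equivalence classes; the essential bound does not give a pointwise
  bound.\<close>

definition Linfty :: "'a measure \<Rightarrow> ('a \<Rightarrow> real) set" where
  "Linfty \<eta> = {f \<in> borel_measurable (completion \<eta>). \<exists>C. AE x in completion \<eta>. \<bar>f x\<bar> \<le> C}"

definition lower_semicontinuous :: "('a::topological_space \<Rightarrow> ereal) \<Rightarrow> bool" where
  "lower_semicontinuous f \<longleftrightarrow> (\<forall>a. open {z. a < f z})"

text \<open>Integral of an extended-real function as the integral of its positive part minus that of its
  negative part (\<^const>\<open>e2ennreal\<close> sends negative values to \<open>0\<close>). It is meaningful when
  at most one of the two is infinite.\<close>

definition ereal_integral :: "'a measure \<Rightarrow> ('a \<Rightarrow> ereal) \<Rightarrow> ereal" where
  "ereal_integral M f =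
     enn2ereal (\<integral>\<^sup>+ z. e2ennreal (f z) \<partial>M) - enn2ereal (\<integral>\<^sup>+ z. e2ennreal (- f z) \<partial>M)"

text \<open>The constraint below holds at every point, not just almost everywhere.\<close>

definition dual_value ::
  "('e::topological_space \<times> 's::topological_space \<Rightarrow> ereal) \<Rightarrow> ('e \<times> 's \<Rightarrow> real) \<Rightarrow>
   'e measure \<Rightarrow> 's measure \<Rightarrow> ereal" where
  "dual_value c h \<eta> \<nu> =
     Sup {ereal ((\<integral>x. f x \<partial>completion \<eta>) + (\<integral>y. g y \<partial>\<nu>)) | f g.
            f \<in> Linfty \<eta> \<and> g \<in> bcontfun \<and>
            (\<forall>x y. ereal (f x + g y) \<le> c (x, y) + ereal (h (x, y)))}"

text \<open>The completion of the coupling is needed because \<open>h\<close> need only be measurable in its first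
  argument with respect to the completed Borel sigma-field.\<close>

definition primal_value ::
  "('e::topological_space \<times> 's::topological_space \<Rightarrow> ereal) \<Rightarrow> ('e \<times> 's \<Rightarrow> real) \<Rightarrow>
   'e measure \<Rightarrow> 's measure \<Rightarrow> ereal" where
  "primal_value c h \<eta> \<nu> =
     Inf {ereal_integral (completion \<gamma>) (\<lambda>z. c z + ereal (h z)) | \<gamma>. \<gamma> \<in> couplings \<eta> \<nu>}"

end

theory Submission
  imports Defs
begin

text \<open>Weak duality is integration of the constraint. For the converse let \<open>d\<close> be a finite dual
  value. The least cost of dominating a function \<open>u\<close> on the product by \<open>f(x) + g(y) + t w\<close>, where
  \<open>w \<le> c + h\<close> has price \<open>d\<close>, is a sublinear functional of \<open>u\<close>, and it is finite precisely because
  \<open>d\<close> bounds the dual problem. The Hahn--Banach theorem gives a linear functional \<open>L\<close> below it;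
  \<open>L\<close> is positive, has marginals \<open>\<eta>\<close> and \<open>\<nu>\<close>, and satisfies \<open>L w \<le> d\<close> for \<open>w \<le> c + h\<close>.

  On the algebra of sets with finitely many different sections \<open>W\<^sub>x\<close>, all of them \<open>\<nu>\<close>-continuity
  sets, \<open>W \<mapsto> L 1\<^sub>W\<close> is a content whose second marginal is \<open>\<nu>\<close>: the indicator
  of a continuity set lies between continuous functions of \<open>y\<close> with nearly equal integrals. Tightness of
  \<open>\<nu>\<close> makes the content countably additive, so that it extends to a coupling \<open>\<gamma>\<close>. A lower
  semicontinuous \<open>c\<close> is the increasing limit of functions \<open>s\<^sub>n\<close> that are simple over this
  algebra, hence \<open>\<integral> (s\<^sub>n + h) d\<gamma> = L (s\<^sub>n + h) \<le> d\<close>, and monotone convergence shows that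
  \<open>\<gamma>\<close> is optimal.\<close>

section \<open>The Hahn--Banach theorem\<close>

text \<open>Homogeneity for t > 0 already forces the value 0 at the zero function. Everything is
  relative to a set X because the space used later depends on a measure and is therefore not a
  type.\<close>

definition sublinear_on :: "('a \<Rightarrow> real) set \<Rightarrow> (('a \<Rightarrow> real) \<Rightarrow> real) \<Rightarrow> bool" where
  "sublinear_on X p \<longleftrightarrow>
     (\<forall>u\<in>X. \<forall>v\<in>X. p (\<lambda>z. u z + v z) \<le> p u + p v) \<and>
     (\<forall>u\<in>X. \<forall>t>0. p (\<lambda>z. t * u z) = t * p u)"

lemma sublinear_on_add:
  "sublinear_on X p \<Longrightarrow> u \<in> X \<Longrightarrow> v \<in> X \<Longrightarrow> p (\<lambda>z. u z + v z) \<le> p u + p v"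
  unfolding sublinear_on_def by blast

lemma sublinear_on_scale:
  "sublinear_on X p \<Longrightarrow> u \<in> X \<Longrightarrow> t > 0 \<Longrightarrow> p (\<lambda>z. t * u z) = t * p u"
  unfolding sublinear_on_def by blast

locale function_space =
  fixes X :: "('a \<Rightarrow> real) set"
  assumes zero: "(\<lambda>_. 0) \<in> X"
    and add: "u \<in> X \<Longrightarrow> v \<in> X \<Longrightarrow> (\<lambda>z. u z + v z) \<in> X"
    and scale: "u \<in> X \<Longrightarrow> (\<lambda>z. t * u z) \<in> X"
begin

lemma minus: "u \<in> X \<Longrightarrow> (\<lambda>z. - u z) \<in> X"
  using scale[of u "-1"] by simp

lemma sublinear_zero:
  assumes "sublinear_on X p" shows "p (\<lambda>_. 0) = 0"
proof -
  have "\<forall>t>0. p (\<lambda>z. t * 0) = t * p (\<lambda>_. 0)"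
    using sublinear_on_scale[OF assms zero] by simp
  from this[rule_format, of 2] have "p (\<lambda>_. 0) = 2 * p (\<lambda>_. 0)" by simp
  then show ?thesis by simp
qed

lemma sublinear_lower:
  assumes p: "sublinear_on X p" and u: "u \<in> X" shows "- p (\<lambda>z. - u z) \<le> p u"
proof -
  have "p (\<lambda>z. u z + - u z) \<le> p u + p (\<lambda>z. - u z)"
    by (rule sublinear_on_add[OF p u minus[OF u]])
  then show ?thesis using sublinear_zero[OF p] by simp
qed

text \<open>Subadditivity of an infimum asks for one functional that is good for both summands;
  \<open>dir\<close> supplies it below any two candidates. In the application of Zorn's lemma the
  directed family is a chain.\<close>

lemma sublinear_INF:
  assumes ne: "C \<noteq> {}" and sub: "\<And>p. p \<in> C \<Longrightarrow> sublinear_on X p"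
    and bdd: "\<And>u. u \<in> X \<Longrightarrow> bdd_below ((\<lambda>p. p u) ` C)"
    and dir: "\<And>p p'. p \<in> C \<Longrightarrow> p' \<in> C \<Longrightarrow> \<exists>r\<in>C. \<forall>u\<in>X. r u \<le> p u \<and> r u \<le> p' u"
  shows "sublinear_on X (\<lambda>u. INF p\<in>C. p u)"
  unfolding sublinear_on_def
proof (intro conjI ballI allI impI)
  fix u v assume u: "u \<in> X" and v: "v \<in> X"
  have "(INF p\<in>C. p (\<lambda>z. u z + v z)) \<le> p u + p' v" if "p \<in> C" "p' \<in> C" for p p'
  proof -
    obtain r where r: "r \<in> C" "r u \<le> p u" "r v \<le> p' v" using dir[OF \<open>p \<in> C\<close> \<open>p' \<in> C\<close>] u v by blast
    have "(INF p\<in>C. p (\<lambda>z. u z + v z)) \<le> r (\<lambda>z. u z + v z)"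
      by (intro cINF_lower bdd add u v r)
    also have "\<dots> \<le> r u + r v" using sub[OF r(1)] u v unfolding sublinear_on_def by blast
    finally show ?thesis using r by linarith
  qed
  then have "(INF p\<in>C. p (\<lambda>z. u z + v z)) - p' v \<le> (INF p\<in>C. p u)" if "p' \<in> C" for p'
    using that ne by (intro cINF_greatest) (auto simp: algebra_simps)
  then have "(INF p\<in>C. p (\<lambda>z. u z + v z)) - (INF p\<in>C. p u) \<le> (INF p\<in>C. p v)"
    using ne by (intro cINF_greatest) (auto simp: algebra_simps)
  then show "(INF p\<in>C. p (\<lambda>z. u z + v z)) \<le> (INF p\<in>C. p u) + (INF p\<in>C. p v)" by simp
next
  fix u and t :: real assume u: "u \<in> X" and t: "t > 0"
  have eq: "p (\<lambda>z. t * u z) = t * p u" if "p \<in> C" for p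
    using sub[OF that] u t unfolding sublinear_on_def by blast
  have "(INF p\<in>C. p (\<lambda>z. t * u z)) = (INF p\<in>C. t * p u)"
    by (intro INF_cong refl eq)
  also have "\<dots> = t * (INF p\<in>C. p u)"
  proof (rule antisym)
    have "(INF p\<in>C. t * p u) / t \<le> (INF p\<in>C. p u)"
    proof (rule cINF_greatest[OF ne])
      fix p assume "p \<in> C"
      have "bdd_below ((\<lambda>p. t * p u) ` C)"
        using bdd[OF scale[OF u, of t]] by (simp add: eq cong: image_cong)
      then show "(INF p\<in>C. t * p u) / t \<le> p u"
        using cINF_lower[OF _ \<open>p \<in> C\<close>] t by (simp add: pos_divide_le_eq mult.commute)
    qed
    then show "(INF p\<in>C. t * p u) \<le> t * (INF p\<in>C. p u)"
      using t by (simp add: pos_divide_le_eq mult.commute)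
    show "t * (INF p\<in>C. p u) \<le> (INF p\<in>C. t * p u)"
      using t ne cINF_lower[OF bdd[OF u]] by (intro cINF_greatest) (auto intro!: mult_left_mono)
  qed
  finally show "(INF p\<in>C. p (\<lambda>z. t * u z)) = t * (INF p\<in>C. p u)" .
qed

text \<open>For a sublinear \<open>p\<close> and a direction \<open>w\<close>, the functional
  \<open>u \<mapsto> inf {p (u + t w) - t p w | t > 0}\<close> is again sublinear and below \<open>p\<close>;
  it differs from \<open>p\<close> unless \<open>p\<close> is additive in direction \<open>w\<close>.\<close>

lemma sublinear_shift:
  assumes p: "sublinear_on X p" and w: "w \<in> X"
  obtains r where "sublinear_on X r" "\<And>u. u \<in> X \<Longrightarrow> r u \<le> p u"
    "\<And>u. u \<in> X \<Longrightarrow> r u \<le> p (\<lambda>z. u z + w z) - p w"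
proof -
  define r where "r u = (INF t\<in>{0<..}. p (\<lambda>z. u z + t * w z) - t * p w)" for u
  have sub: "p (\<lambda>z. u z + v z) \<le> p u + p v" if "u \<in> X" "v \<in> X" for u v
    using p that unfolding sublinear_on_def by blast
  have hom: "p (\<lambda>z. t * u z) = t * p u" if "u \<in> X" "t > 0" for t u
    using p that unfolding sublinear_on_def by blast
  have X1: "(\<lambda>z. u z + t * w z) \<in> X" if "u \<in> X" for u t by (intro add scale w that)
  \<comment> \<open>The lower bound does not involve t, so the infimum defining \<open>r\<close> is
    over a set bounded below.\<close>
  have low: "- p (\<lambda>z. - u z) \<le> p (\<lambda>z. u z + t * w z) - t * p w" if u: "u \<in> X" and t: "t > 0" for u t
  proof -
    have "p (\<lambda>z. t * w z) \<le> p (\<lambda>z. u z + t * w z) + p (\<lambda>z. - u z)"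
      using sub[OF X1[OF u] minus[OF u], of t] by simp
    then show ?thesis using hom[OF w t] by linarith
  qed
  have bdd: "bdd_below ((\<lambda>t. p (\<lambda>z. u z + t * w z) - t * p w) ` {0<..})" if "u \<in> X" for u
    using low[OF that] by (intro bdd_belowI2) auto
  have le: "r u \<le> p (\<lambda>z. u z + t * w z) - t * p w" if "u \<in> X" "t > 0" for u t
    unfolding r_def using that by (intro cINF_lower bdd) auto
  have ge: "b \<le> r u" if "\<And>t. t > 0 \<Longrightarrow> b \<le> p (\<lambda>z. u z + t * w z) - t * p w" for u b
    unfolding r_def using that by (intro cINF_greatest) auto
  have sr: "r (\<lambda>z. u z + v z) \<le> r u + r v" if u: "u \<in> X" and v: "v \<in> X" for u v
  proof -
    \<comment> \<open>Independent parameters s and t for the two summands merge into the single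
      parameter s + t for the sum.\<close>
    have 1: "r (\<lambda>z. u z + v z) \<le> (p (\<lambda>z. u z + s * w z) - s * p w) + (p (\<lambda>z. v z + t * w z) - t * p w)"
      if "s > 0" "t > 0" for s t
    proof -
      have "r (\<lambda>z. u z + v z) \<le> p (\<lambda>z. u z + v z + (s + t) * w z) - (s + t) * p w"
        using that by (intro le add u v) auto
      also have "(\<lambda>z. u z + v z + (s + t) * w z) = (\<lambda>z. (u z + s * w z) + (v z + t * w z))"
        by (simp add: algebra_simps)
      also have "p \<dots> \<le> p (\<lambda>z. u z + s * w z) + p (\<lambda>z. v z + t * w z)"
        by (intro sub X1 u v)
      finally show ?thesis by (simp add: algebra_simps)
    qed
    have "r (\<lambda>z. u z + v z) - (p (\<lambda>z. v z + t * w z) - t * p w) \<le> r u" if "t > 0" for t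
      using 1 that by (intro ge) (simp add: algebra_simps)
    then have "r (\<lambda>z. u z + v z) - r u \<le> r v"
      by (intro ge) (simp add: algebra_simps)
    then show ?thesis by simp
  qed
  have hom1: "r (\<lambda>z. t * u z) \<le> t * r u" if u: "u \<in> X" and t: "t > 0" for u t
  proof -
    have "r (\<lambda>z. t * u z) / t \<le> r u"
    proof (rule ge)
      fix s :: real assume s: "s > 0"
      have "r (\<lambda>z. t * u z) \<le> p (\<lambda>z. t * u z + (t * s) * w z) - (t * s) * p w"
        using s t by (intro le scale u) auto
      also have "(\<lambda>z. t * u z + (t * s) * w z) = (\<lambda>z. t * (u z + s * w z))"
        by (simp add: algebra_simps)
      also have "p \<dots> = t * p (\<lambda>z. u z + s * w z)" by (intro hom X1 u t)
      finally show "r (\<lambda>z. t * u z) / t \<le> p (\<lambda>z. u z + s * w z) - s * p w"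
        using t by (simp add: field_simps)
    qed
    then show ?thesis using t by (simp add: field_simps)
  qed
  \<comment> \<open>The missing inequality is \<open>hom1\<close> itself, applied to t u with the
    factor 1/t.\<close>
  have homr: "r (\<lambda>z. t * u z) = t * r u" if u: "u \<in> X" and t: "t > 0" for u t
  proof (rule antisym[OF hom1[OF u t]])
    have "r (\<lambda>z. inverse t * (t * u z)) \<le> inverse t * r (\<lambda>z. t * u z)"
      using t by (intro hom1 scale u) auto
    then show "t * r u \<le> r (\<lambda>z. t * u z)"
      using t by (simp add: field_simps)
  qed
  have rp: "r u \<le> p u" if u: "u \<in> X" for u
  proof -
    have "r u \<le> p (\<lambda>z. u z + 1 * w z) - 1 * p w" by (intro le u) auto
    also have "\<dots> \<le> p u" using sub[OF u w] by simp
    finally show ?thesis .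
  qed
  show thesis
  proof
    show "sublinear_on X r" unfolding sublinear_on_def using sr homr by blast
    show "r u \<le> p u" if "u \<in> X" for u by (rule rp[OF that])
    show "r u \<le> p (\<lambda>z. u z + w z) - p w" if "u \<in> X" for u using le[OF that, of 1] by simp
  qed
qed

text \<open>A minimal sublinear functional below \<open>q\<close> exists by Zorn's lemma, and
  minimality forces linearity.\<close>

theorem hahn_banach:
  assumes q: "sublinear_on X q"
  obtains L where "\<And>u v. u \<in> X \<Longrightarrow> v \<in> X \<Longrightarrow> L (\<lambda>z. u z + v z) = L u + L v"
    and "\<And>u t. u \<in> X \<Longrightarrow> L (\<lambda>z. t * u z) = t * L u"
    and "\<And>u. u \<in> X \<Longrightarrow> L u \<le> q u"
proof -
  \<comment> \<open>Functionals are normalised to 0 off X, so that the order on total functions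
    amounts to comparison on X; \<open>cut\<close> performs the normalisation.\<close>
  define S where "S = {p. sublinear_on X p \<and> (\<forall>u\<in>X. p u \<le> q u) \<and> (\<forall>u. u \<notin> X \<longrightarrow> p u = 0)}"
  define cut where "cut p = (\<lambda>u. if u \<in> X then p u else (0::real))" for p :: "('a \<Rightarrow> real) \<Rightarrow> real"
  have cut: "cut p \<in> S" if "sublinear_on X p" "\<And>u. u \<in> X \<Longrightarrow> p u \<le> q u" for p
    using that unfolding S_def cut_def sublinear_on_def by (auto simp: add scale)
  \<comment> \<open>The order is reversed, since Zorn's lemma produces maximal elements and a
    minimal functional is wanted.\<close>
  let ?P = "\<lambda>p p'::('a \<Rightarrow> real) \<Rightarrow> real. p' \<le> p"
  have low: "- q (\<lambda>z. - u z) \<le> p u" if "p \<in> S" "u \<in> X" for p u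
    using that sublinear_lower[of p u] minus[of u] unfolding S_def by force
  have "\<exists>m\<in>S. \<forall>a\<in>S. ?P m a \<longrightarrow> a = m"
  proof (rule predicate_Zorn)
    show "partial_order_on S (relation_of ?P S)"
      by (rule partial_order_on_relation_ofI) auto
    fix C assume C: "C \<in> Chains (relation_of ?P S)"
    then have CS: "C \<subseteq> S" and tot: "\<And>p p'. p \<in> C \<Longrightarrow> p' \<in> C \<Longrightarrow> p \<le> p' \<or> p' \<le> p"
      unfolding Chains_def relation_of_def by auto
    show "\<exists>u\<in>S. \<forall>a\<in>C. ?P a u"
    proof (cases "C = {}")
      case True
      then show ?thesis using cut[OF q] by auto
    next
      case False
      have bdd: "bdd_below ((\<lambda>p. p u) ` C)" if "u \<in> X" for u
        using low[OF _ that] CS by (intro bdd_belowI2) auto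
      let ?m = "\<lambda>u. INF p\<in>C. p u"
      have sub: "sublinear_on X ?m"
      proof (rule sublinear_INF[OF False _ bdd])
        show "sublinear_on X p" if "p \<in> C" for p using that CS unfolding S_def by auto
        show "\<exists>r\<in>C. \<forall>u\<in>X. r u \<le> p u \<and> r u \<le> p' u" if "p \<in> C" "p' \<in> C" for p p'
          using tot[OF that] that by (auto simp: le_fun_def)
      qed
      have lower: "?m u \<le> p u" if "p \<in> C" "u \<in> X" for p u
        by (intro cINF_lower bdd that)
      have "cut ?m \<in> S"
      proof (rule cut[OF sub])
        fix u assume u: "u \<in> X"
        obtain p where "p \<in> C" using False by auto
        then show "?m u \<le> q u" using lower[OF _ u, of p] CS u unfolding S_def by force
      qed
      moreover have "cut ?m \<le> p" if "p \<in> C" for p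
      proof (rule le_funI)
        show "cut ?m u \<le> p u" for u
          using lower[OF that, of u] that CS unfolding cut_def S_def by auto
      qed
      ultimately show ?thesis by blast
    qed
  qed
  then obtain L where L: "L \<in> S" and min: "\<And>a. a \<in> S \<Longrightarrow> a \<le> L \<Longrightarrow> a = L" by blast
  have subL: "sublinear_on X L" and Lq: "\<And>u. u \<in> X \<Longrightarrow> L u \<le> q u" and L0: "\<And>u. u \<notin> X \<Longrightarrow> L u = 0"
    using L unfolding S_def by auto
  have additive: "L (\<lambda>z. u z + w z) = L u + L w" if u: "u \<in> X" and w: "w \<in> X" for u w
  proof (rule antisym)
    show "L (\<lambda>z. u z + w z) \<le> L u + L w"
      using subL u w unfolding sublinear_on_def by blast
    obtain r where r: "sublinear_on X r" "\<And>u. u \<in> X \<Longrightarrow> r u \<le> L u"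
      "\<And>u. u \<in> X \<Longrightarrow> r u \<le> L (\<lambda>z. u z + w z) - L w"
      using sublinear_shift[OF subL w] by blast
    \<comment> \<open>Minimality identifies \<open>r\<close> with L on X, and the last bound on
      \<open>r\<close> then becomes superadditivity of L in direction w.\<close>
    have "cut r \<in> S" using r(1) r(2) Lq by (intro cut) (auto intro: order_trans)
    moreover have "cut r \<le> L" unfolding le_fun_def cut_def using r(2) L0 by auto
    ultimately have "cut r = L" by (rule min)
    then have "cut r u = L u" by simp
    then have "r u = L u" using u by (simp add: cut_def)
    then show "L u + L w \<le> L (\<lambda>z. u z + w z)" using r(3)[OF u] by simp
  qed
  have hom: "L (\<lambda>z. t * u z) = t * L u" if "u \<in> X" "t > 0" for t u
    using subL that unfolding sublinear_on_def by blast
  have neg: "L (\<lambda>z. - u z) = - L u" if "u \<in> X" for u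
    using additive[OF that minus[OF that]] sublinear_zero[OF subL] by simp
  have "L (\<lambda>z. t * u z) = t * L u" if u: "u \<in> X" for t u
  proof -
    consider "t > 0" | "t = 0" | "t < 0" by linarith
    then show ?thesis
    proof cases
      case 1 then show ?thesis by (rule hom[OF u])
    next
      case 2 then show ?thesis using sublinear_zero[OF subL] by simp
    next
      case 3
      then have "L (\<lambda>z. - t * - u z) = - t * L (\<lambda>z. - u z)" by (intro hom minus u) auto
      then show ?thesis using neg[OF u] by simp
    qed
  qed
  with additive Lq show thesis using that by blast
qed

end

section \<open>Continuity sets of a probability on a Polish space\<close>

text \<open>A form of Cantor's intersection theorem. A sequence of points y n in K n is totally
  bounded, since from index N on it stays in K N, which finitely many balls of radius 1/(N+1) cover.
  By completeness a subsequence converges, and its limit lies in every closed K n.\<close>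

lemma nested_closed_totally_bounded:
  fixes K :: "nat \<Rightarrow> 'a::complete_space set"
  assumes closed: "\<And>n. closed (K n)" and ne: "\<And>n. K n \<noteq> {}" and dec: "decseq K"
    and tb: "\<And>n. \<exists>F. finite F \<and> K n \<subseteq> (\<Union>y\<in>F. cball y (1 / Suc n))"
  shows "(\<Inter>n. K n) \<noteq> {}"
proof -
  have "\<exists>y. \<forall>n. y n \<in> K n" using ne by (intro choice) blast
  then obtain y where y: "\<And>n. y n \<in> K n" by blast
  have "compact (closure (range y))"
    unfolding compact_eq_totally_bounded complete_eq_closed
  proof (intro conjI allI impI)
    show "closed (closure (range y))" by simp
    fix e :: real assume "e > 0"
    then obtain N where N: "1 / Suc N < e" using nat_approx_posE by metis
    obtain F where F: "finite F" "K N \<subseteq> (\<Union>y\<in>F. cball y (1 / Suc N))" using tb by blast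
    have "y n \<in> y ` {..<N} \<union> (\<Union>y\<in>F. cball y (1 / Suc N))" for n
      using y[of n] F(2) decseqD[OF dec, of N n] by (cases "n < N") fastforce+
    then have "closure (range y) \<subseteq> y ` {..<N} \<union> (\<Union>y\<in>F. cball y (1 / Suc N))"
      using F(1) by (intro closure_minimal closed_Un closed_UN finite_imp_closed) blast+
    also have "\<dots> \<subseteq> (\<Union>x\<in>y ` {..<N} \<union> F. ball x e)"
      using N \<open>e > 0\<close> by fastforce
    finally show "\<exists>k. finite k \<and> closure (range y) \<subseteq> (\<Union>x\<in>k. ball x e)"
      using F(1) by (intro exI[of _ "y ` {..<N} \<union> F"]) simp
  qed
  then have "seq_compact (closure (range y))" by (simp add: compact_eq_seq_compact_metric)
  moreover have "\<forall>n. y n \<in> closure (range y)" using closure_subset[of "range y"] by auto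
  ultimately obtain l \<phi> where \<phi>: "strict_mono \<phi>" "(y \<circ> \<phi>) \<longlonglongrightarrow> l"
    unfolding seq_compact_def by blast
  have "l \<in> K n" for n
  proof (rule Lim_in_closed_set[OF closed _ _ \<phi>(2)])
    have "(y \<circ> \<phi>) k \<in> K n" if "n \<le> k" for k
      using y[of "\<phi> k"] decseqD[OF dec, of n "\<phi> k"] seq_suble[OF \<phi>(1), of k] that by auto
    then show "\<forall>\<^sub>F k in sequentially. (y \<circ> \<phi>) k \<in> K n"
      unfolding eventually_sequentially by blast
  qed simp
  then show ?thesis by blast
qed

definition continuity_sets :: "'a::topological_space measure \<Rightarrow> 'a set set" where
  "continuity_sets \<nu> = {V \<in> sets borel. measure \<nu> (frontier V) = 0}"

section \<open>The algebra of continuity sets\<close>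

locale borel_prob = prob_space \<nu> for \<nu> :: "'a::topological_space measure" +
  assumes sets_eq [measurable_cong]: "sets \<nu> = sets borel"
begin

lemma space_eq [simp]: "space \<nu> = UNIV"
  using sets_eq_imp_space_eq[OF sets_eq] by simp

lemma null_mono: "measure \<nu> B = 0 \<Longrightarrow> A \<subseteq> B \<Longrightarrow> B \<in> sets borel \<Longrightarrow> measure \<nu> A = 0"
  using finite_measure_mono[of A B] sets_eq measure_nonneg[of \<nu> A] by auto

lemma frontier_borel [measurable, simp]: "frontier V \<in> sets borel"
  by (simp add: frontier_def)

lemma continuity_sets_borel: "V \<in> continuity_sets \<nu> \<Longrightarrow> V \<in> sets borel"
  unfolding continuity_sets_def by simp

lemma continuity_sets_Compl: "V \<in> continuity_sets \<nu> \<Longrightarrow> - V \<in> continuity_sets \<nu>"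
  unfolding continuity_sets_def by (auto simp: borel_comp)

lemma continuity_sets_empty: "{} \<in> continuity_sets \<nu>"
  unfolding continuity_sets_def by auto

lemma continuity_sets_Un:
  assumes "V \<in> continuity_sets \<nu>" "W \<in> continuity_sets \<nu>"
  shows "V \<union> W \<in> continuity_sets \<nu>"
proof -
  have "measure \<nu> (frontier V \<union> frontier W) \<le> measure \<nu> (frontier V) + measure \<nu> (frontier W)"
    using sets_eq by (intro measure_Un_le) auto
  then have "measure \<nu> (frontier V \<union> frontier W) = 0"
    using assms unfolding continuity_sets_def by (simp add: measure_le_0_iff)
  then have "measure \<nu> (frontier (V \<union> W)) = 0"
    by (rule null_mono[OF _ frontier_Un_subset]) auto
  then show ?thesis using assms unfolding continuity_sets_def by auto
qed

lemma continuity_sets_algebra: "algebra UNIV (continuity_sets \<nu>)"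
  unfolding algebra_iff_Un
  using continuity_sets_empty continuity_sets_Un continuity_sets_Compl
  by (auto simp: Compl_eq_Diff_UNIV)

lemma measure_interior_continuity_set:
  assumes V: "V \<in> continuity_sets \<nu>" shows "measure \<nu> (interior V) = measure \<nu> V"
proof (rule antisym)
  have Vm: "V \<in> sets \<nu>" using V sets_eq by (simp add: continuity_sets_def)
  then show "measure \<nu> (interior V) \<le> measure \<nu> V"
    by (intro finite_measure_mono interior_subset)
  have "measure \<nu> V \<le> measure \<nu> (interior V \<union> frontier V)"
    using closure_subset[of V] sets_eq by (intro finite_measure_mono) (auto simp: frontier_def)
  also have "\<dots> \<le> measure \<nu> (interior V) + measure \<nu> (frontier V)"
    using sets_eq by (intro measure_Un_le) auto
  finally show "measure \<nu> V \<le> measure \<nu> (interior V)"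
    using V by (simp add: continuity_sets_def)
qed

text \<open>The statement for interiors, applied to the complement.\<close>

lemma measure_closure_continuity_set:
  assumes V: "V \<in> continuity_sets \<nu>" shows "measure \<nu> (closure V) = measure \<nu> V"
proof -
  have "measure \<nu> (interior (- V)) = measure \<nu> (- V)"
    by (intro measure_interior_continuity_set continuity_sets_Compl V)
  moreover have "measure \<nu> (- W) = 1 - measure \<nu> W" if "W \<in> sets borel" for W
    using prob_compl[of W] that sets_eq by (simp add: Compl_eq_Diff_UNIV)
  ultimately show ?thesis
    using continuity_sets_borel[OF V] by (simp add: interior_complement)
qed

end

section \<open>Balls with null spheres\<close>

locale metric_borel_prob = borel_prob \<nu> for \<nu> :: "'a::metric_space measure"
begin

text \<open>Different radii give disjoint spheres, and a finite measure charges at most countably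
  many of them. Formally, the law of the distance to y has countably many atoms, while the interval
  is uncountable.\<close>

lemma null_sphere_radius:
  assumes "a < b" obtains r where "a < r" "r < b" "measure \<nu> (sphere y r) = 0"
proof -
  have m: "dist y \<in> borel_measurable \<nu>"
    unfolding measurable_cong_sets[OF sets_eq refl]
    by (intro borel_measurable_continuous_onI continuous_intros)
  then interpret D: prob_space "distr \<nu> borel (dist y)" by (rule prob_space_distr)
  have "countable {r. measure (distr \<nu> borel (dist y)) {r} \<noteq> 0}" by (rule D.countable_support)
  then have "\<not> {a<..<b} \<subseteq> {r. measure (distr \<nu> borel (dist y)) {r} \<noteq> 0}"
    using uncountable_open_interval[of a b] assms countable_subset by blast
  then obtain r where r: "a < r" "r < b" "measure (distr \<nu> borel (dist y)) {r} = 0" by auto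
  have "dist y -` {r} \<inter> space \<nu> = sphere y r" by auto
  then have "measure \<nu> (sphere y r) = 0" using r(3) m by (simp add: measure_distr)
  with r that show thesis by blast
qed

lemma sphere_borel: "sphere y r \<in> sets borel"
  unfolding sphere_def by (intro borel_closed closed_Collect_eq continuous_intros)

lemma ball_continuity_set:
  assumes "measure \<nu> (sphere y r) = 0" shows "ball y r \<in> continuity_sets \<nu>"
proof -
  have "closure (ball y r) \<subseteq> cball y r"
    by (intro closure_minimal ball_subset_cball closed_cball)
  then have "frontier (ball y r) \<subseteq> sphere y r"
    unfolding frontier_def by (auto simp: interior_open)
  then have "measure \<nu> (frontier (ball y r)) = 0"
    by (rule null_mono[OF assms]) (rule sphere_borel)
  then show ?thesis unfolding continuity_sets_def by auto
qed

lemma cball_continuity_set: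
  assumes "measure \<nu> (sphere y r) = 0" shows "cball y r \<in> continuity_sets \<nu>"
proof -
  have "ball y r \<subseteq> interior (cball y r)"
    by (intro interior_maximal ball_subset_cball open_ball)
  then have "frontier (cball y r) \<subseteq> sphere y r"
    unfolding frontier_def by force
  then have "measure \<nu> (frontier (cball y r)) = 0"
    by (rule null_mono[OF assms]) (rule sphere_borel)
  then show ?thesis unfolding continuity_sets_def by (auto intro: borel_closed)
qed

end

section \<open>Bases and inner approximation in Polish spaces\<close>

locale polish_prob = metric_borel_prob \<nu> for \<nu> :: "'a::polish_space measure"
begin

lemma continuity_basis:
  obtains B where "countable B" "topological_basis B" "B \<subseteq> continuity_sets \<nu>"
proof -
  obtain D :: "'a set" where D: "countable D" "\<And>X. open X \<Longrightarrow> X \<noteq> {} \<Longrightarrow> \<exists>d\<in>D. d \<in> X"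
    by (rule countable_dense_setE) blast
  \<comment> \<open>The two-sided control of the radius serves both halves of the basis property:
    the lower bound lets the ball around a nearby dense point reach x, the upper bound keeps it
    inside \<open>ball x e\<close>.\<close>
  have "\<exists>r. 1 / (2 * Suc n) < r \<and> r < 1 / Suc n \<and> measure \<nu> (sphere y r) = 0" for y and n :: nat
    using null_sphere_radius[of "1 / (2 * Suc n)" "1 / Suc n" y] by (auto simp: field_simps)
  then have "\<exists>r. \<forall>y n. 1 / (2 * Suc n) < r y n \<and> r y n < 1 / Suc n \<and> measure \<nu> (sphere y (r y n)) = 0"
    by (intro choice allI)
  then obtain r where r: "\<And>y n. 1 / (2 * Suc n) < r y n" "\<And>y n. r y n < 1 / Suc n"
    "\<And>y n. measure \<nu> (sphere y (r y n)) = 0"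
    by blast
  define B where "B = (\<lambda>(y, n). ball y (r y n)) ` (D \<times> UNIV)"
  have "countable B" unfolding B_def using D(1) by auto
  moreover have "B \<subseteq> continuity_sets \<nu>" unfolding B_def using ball_continuity_set r(3) by auto
  moreover have "topological_basis B"
  proof (rule topological_basisI)
    show "open b" if "b \<in> B" for b using that unfolding B_def by auto
    fix O' and x :: 'a assume "open O'" "x \<in> O'"
    then obtain e where e: "e > 0" "ball x e \<subseteq> O'" using open_contains_ball by blast
    obtain n where n: "1 / Suc n < e / 2" using e(1) nat_approx_posE[of "e / 2"] by auto
    have "ball x (1 / (2 * Suc n)) \<noteq> {}" by auto
    then obtain d where d: "d \<in> D" "dist x d < 1 / (2 * Suc n)"
      using D(2)[OF open_ball, of x] by (auto simp del: ball_eq_empty)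
    have "ball d (r d n) \<subseteq> ball x e"
    proof
      fix z assume "z \<in> ball d (r d n)"
      moreover have "dist x z \<le> dist x d + dist d z" by (rule dist_triangle)
      ultimately show "z \<in> ball x e"
        using d(2) r(1)[of n d] r(2)[of d n] n by auto
    qed
    moreover have "x \<in> ball d (r d n)" using d(2) r(1)[of n d] by (simp add: dist_commute)
    ultimately show "\<exists>b\<in>B. x \<in> b \<and> b \<subseteq> O'" using d(1) e(2) unfolding B_def by blast
  qed
  ultimately show thesis using that by blast
qed

text \<open>Inner regularity gives a compact K inside the interior of V that carries almost all of
  the mass, but K itself need not be a continuity set. It is therefore enlarged to a finite union of
  closed balls with null spheres and radii below r that stay in the interior. The result is closed
  and coverable at scale r, which is all the compactness used later.\<close>

lemma continuity_set_inner_approx: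
  assumes V: "V \<in> continuity_sets \<nu>" and \<delta>: "\<delta> > 0" and r: "r > 0"
  obtains V' F where "V' \<in> continuity_sets \<nu>" "closed V'" "V' \<subseteq> V" "measure \<nu> (V - V') < \<delta>"
    "finite F" "V' \<subseteq> (\<Union>y\<in>F. cball y r)"
proof -
  have "emeasure \<nu> (interior V) = (SUP K \<in> {K. K \<subseteq> interior V \<and> compact K}. emeasure \<nu> K)"
    by (intro inner_regular) (auto simp: sets_eq emeasure_eq_measure)
  moreover have "\<exists>K. K \<subseteq> interior V \<and> compact K \<and> measure \<nu> (interior V) - \<delta> < measure \<nu> K"
  proof (rule ccontr)
    assume "\<not> ?thesis"
    then have "(SUP K \<in> {K. K \<subseteq> interior V \<and> compact K}. emeasure \<nu> K)
        \<le> ennreal (measure \<nu> (interior V) - \<delta>)"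
      by (intro SUP_least) (auto simp: emeasure_eq_measure not_less intro!: ennreal_leI)
    with calculation have "ennreal (measure \<nu> (interior V)) \<le> ennreal (measure \<nu> (interior V) - \<delta>)"
      by (simp add: emeasure_eq_measure)
    \<comment> \<open>The maximum appears because \<open>ennreal\<close> sends negative numbers to
      0. If the interior has no mass, the empty set is already a suitable K.\<close>
    then have le: "measure \<nu> (interior V) \<le> max 0 (measure \<nu> (interior V) - \<delta>)"
      by (auto simp: ennreal_le_iff2)
    with \<delta> have "measure \<nu> (interior V) = 0" using measure_nonneg[of \<nu> "interior V"] by linarith
    with \<open>\<not> ?thesis\<close> \<delta> show False
      by (metis compact_empty diff_0 empty_subsetI measure_empty neg_less_0_iff_less)
  qed
  ultimately obtain K where K: "K \<subseteq> interior V" "compact K" "measure \<nu> (interior V) - \<delta> < measure \<nu> K"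
    by blast
  have "\<exists>s. 0 < s \<and> s < r \<and> cball y s \<subseteq> interior V \<and> measure \<nu> (sphere y s) = 0" if "y \<in> K" for y
  proof -
    have "y \<in> interior V" using that K(1) by blast
    then obtain e where e: "e > 0" "cball y e \<subseteq> interior V"
      using open_contains_cball[of "interior V"] by auto
    obtain s where "0 < s" "s < min e r" "measure \<nu> (sphere y s) = 0"
      using null_sphere_radius[of 0 "min e r" y] e r by auto
    moreover from this e have "cball y s \<subseteq> interior V" by (auto simp: subset_eq)
    ultimately show ?thesis by auto
  qed
  then obtain s where s: "\<And>y. y \<in> K \<Longrightarrow> 0 < s y" "\<And>y. y \<in> K \<Longrightarrow> s y < r"
    "\<And>y. y \<in> K \<Longrightarrow> cball y (s y) \<subseteq> interior V" "\<And>y. y \<in> K \<Longrightarrow> measure \<nu> (sphere y (s y)) = 0"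
    by metis
  obtain F where F: "F \<subseteq> K" "finite F" "K \<subseteq> (\<Union>y\<in>F. ball y (s y))"
    using compactE_image[OF K(2), of K "\<lambda>y. ball y (s y)"] s(1) by force
  interpret cs: algebra UNIV "continuity_sets \<nu>" by (rule continuity_sets_algebra)
  define V' where "V' = (\<Union>y\<in>F. cball y (s y))"
  have V'_cs: "V' \<in> continuity_sets \<nu>"
    unfolding V'_def using F s(4) by (intro cs.finite_UN cball_continuity_set) auto
  have sub: "V' \<subseteq> interior V" unfolding V'_def using F(1) s(3) by (intro UN_least) auto
  have "K \<subseteq> V'"
    unfolding V'_def by (rule order_trans[OF F(3)]) (intro UN_mono ball_subset_cball subset_refl)
  then have "measure \<nu> K \<le> measure \<nu> V'"
    using V'_cs sets_eq by (intro finite_measure_mono) (auto simp: continuity_sets_borel)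
  moreover have "measure \<nu> (V - V') = measure \<nu> V - measure \<nu> V'"
    using V V'_cs sub interior_subset[of V] sets_eq
    by (intro finite_measure_Diff) (auto simp: continuity_sets_borel)
  ultimately have "measure \<nu> (V - V') < \<delta>"
    using K(3) measure_interior_continuity_set[OF V] by linarith
  moreover have "V' \<subseteq> (\<Union>y\<in>F. cball y r)"
    unfolding V'_def
    by (intro UN_mono subset_refl subset_cball less_imp_le s(2)) (use F(1) in blast)
  moreover have "closed V'" unfolding V'_def using F(2) by (intro closed_UN) auto
  ultimately show thesis using that V'_cs sub interior_subset[of V] F(2) by blast
qed

end

section \<open>Extending contents to couplings\<close>

text \<open>Applied to a set-valued map, \<open>simple_function\<close> says that only finitely many
  sections occur and that each occurs on a measurable set. In the setting of
  \<open>two_marginals\<close> these are the finite unions of rectangles U x V with U Borel and V a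
  continuity set.\<close>

definition section_algebra ::
  "'e::topological_space measure \<Rightarrow> 's::topological_space measure \<Rightarrow> ('e \<times> 's) set set" where
  "section_algebra \<eta> \<nu> =
     {W. simple_function \<eta> (\<lambda>x. Pair x -` W) \<and> (\<forall>x. Pair x -` W \<in> continuity_sets \<nu>)}"

locale two_marginals = E: borel_prob \<eta> + S: polish_prob \<nu>
  for \<eta> :: "'e::second_countable_topology measure" and \<nu> :: "'s::polish_space measure"
begin

abbreviation "\<A> \<equiv> section_algebra \<eta> \<nu>"

lemma section_algebra_algebra: "algebra UNIV \<A>"
  unfolding algebra_iff_Un
proof (intro conjI ballI)
  show "{} \<in> \<A>" unfolding section_algebra_def by (simp add: S.continuity_sets_empty)
next
  fix W assume W: "W \<in> \<A>"
  have "simple_function \<eta> (\<lambda>x. - (Pair x -` W))"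
    by (rule simple_function_compose1) (use W in \<open>simp add: section_algebra_def\<close>)
  then show "UNIV - W \<in> \<A>"
    using W S.continuity_sets_Compl
    by (auto simp: section_algebra_def vimage_Compl Compl_eq_Diff_UNIV[symmetric])
next
  fix W W' assume W: "W \<in> \<A>" "W' \<in> \<A>"
  have "simple_function \<eta> (\<lambda>x. (Pair x -` W) \<union> (Pair x -` W'))"
    by (rule simple_function_compose2) (use W in \<open>simp_all add: section_algebra_def\<close>)
  then show "W \<union> W' \<in> \<A>"
    using W S.continuity_sets_Un by (auto simp: section_algebra_def)
qed simp

sublocale \<A>: algebra UNIV \<A>
  by (rule section_algebra_algebra)

lemma section_algebra_Times:
  assumes U: "U \<in> sets borel" and V: "V \<in> continuity_sets \<nu>" shows "U \<times> V \<in> \<A>"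
proof -
  have "Pair x -` (U \<times> V) = (if x \<in> U then V else {})" for x by auto
  moreover have "simple_function \<eta> (\<lambda>x. if x \<in> U then V else {})"
    by (intro simple_function_If_set simple_function_const) (use U E.sets_eq in auto)
  ultimately show ?thesis
    using V S.continuity_sets_empty unfolding section_algebra_def by simp
qed

lemma open_continuity_basis:
  obtains B where "countable B" "topological_basis B"
    "\<And>b. b \<in> B \<Longrightarrow> b \<in> \<A>"
proof -
  obtain BE :: "'e set set" where BE: "countable BE" "topological_basis BE"
    using ex_countable_basis by blast
  obtain BS where BS: "countable BS" "topological_basis BS" "BS \<subseteq> continuity_sets \<nu>"
    by (rule S.continuity_basis)
  let ?B = "(\<lambda>(U, V). U \<times> V) ` (BE \<times> BS)"
  have "topological_basis ?B" by (intro topological_basis_prod BE BS)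
  moreover have "countable ?B" using BE BS by auto
  moreover have "b \<in> \<A>" if "b \<in> ?B" for b
  proof -
    from that obtain p where p: "p \<in> BE \<times> BS" "b = (case p of (U, V) \<Rightarrow> U \<times> V)"
      by (rule imageE)
    obtain U V where UV: "U \<in> BE" "V \<in> BS" "b = U \<times> V"
      using p that[of "fst p" "snd p"] by (cases p) simp
    have "open U" using UV BE by (auto intro: topological_basis_open)
    then show ?thesis
      unfolding UV(3) using UV BS by (intro section_algebra_Times) auto
  qed
  ultimately show thesis using that by blast
qed

lemma section_algebra_borel:
  assumes "W \<in> \<A>" shows "W \<in> sets borel"
proof -
  let ?s = "\<lambda>x. Pair x -` W"
  have sf: "simple_function \<eta> ?s" and cs: "\<And>x. ?s x \<in> continuity_sets \<nu>"
    using assms unfolding section_algebra_def by auto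
  have fin: "finite (range ?s)" using simple_functionD(1)[OF sf] by simp
  have "?s -` {V} \<in> sets borel" for V
    using simple_functionD(2)[OF sf, of "{V}"] E.sets_eq by simp
  then have "(?s -` {V}) \<times> V \<in> sets (borel \<Otimes>\<^sub>M borel)" if "V \<in> range ?s" for V
    using that S.continuity_sets_borel[OF cs] by auto
  then have "(\<Union>V\<in>range ?s. (?s -` {V}) \<times> V) \<in> sets (borel \<Otimes>\<^sub>M borel)"
    by (intro sets.finite_UN fin)
  also have "(\<Union>V\<in>range ?s. (?s -` {V}) \<times> V) = W" by auto
  finally show ?thesis by (simp only: borel_prod)
qed

text \<open>One inclusion holds because members of the algebra are finite unions of measurable
  rectangles, the other because the algebra contains a countable basis of the product
  topology.\<close>

lemma sigma_sets_section_algebra: "sigma_sets UNIV \<A> = sets borel"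
proof (rule antisym)
  show "sigma_sets UNIV \<A> \<subseteq> sets borel"
    by (intro borel_sigma_sets_subset subsetI section_algebra_borel)
  obtain B where B: "countable B" "topological_basis B" "\<And>b. b \<in> B \<Longrightarrow> b \<in> \<A>"
    by (rule open_continuity_basis) (rule that)
  have "sets borel = sigma_sets UNIV B"
    unfolding borel_eq_countable_basis[OF B(1,2)] by (rule sets_measure_of) simp
  also have "\<dots> \<subseteq> sigma_sets UNIV \<A>"
    by (intro sigma_sets_mono') (use B(3) in blast)
  finally show "sets borel \<subseteq> sigma_sets UNIV \<A>" .
qed

end

text \<open>Compactness is only used in the second factor: the sets of the algebra have finitely many
  different sections, which are approximated from inside by closed sets covered by finitely many
  small balls.\<close>

locale coupling_content = two_marginals \<eta> \<nu>
  for \<eta> :: "'e::second_countable_topology measure" and \<nu> :: "'s::polish_space measure" +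
  fixes m :: "('e \<times> 's) set \<Rightarrow> real"
  assumes nonneg: "W \<in> section_algebra \<eta> \<nu> \<Longrightarrow> 0 \<le> m W"
    and additive: "W \<in> section_algebra \<eta> \<nu> \<Longrightarrow> W' \<in> section_algebra \<eta> \<nu> \<Longrightarrow> W \<inter> W' = {} \<Longrightarrow>
      m (W \<union> W') = m W + m W'"
    and fst_marginal: "U \<in> sets borel \<Longrightarrow> m (U \<times> UNIV) = measure \<eta> U"
    and snd_marginal: "V \<in> continuity_sets \<nu> \<Longrightarrow> m (UNIV \<times> V) \<le> measure \<nu> V"
begin

section \<open>Monotonicity and marginals of the content\<close>

lemma m_empty: "m {} = 0"
  using additive[of "{}" "{}"] by simp

lemma m_Diff: "W \<in> \<A> \<Longrightarrow> W' \<in> \<A> \<Longrightarrow> W' \<subseteq> W \<Longrightarrow> m W = m W' + m (W - W')"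
  using additive[of W' "W - W'"] by (simp add: Un_absorb1 \<A>.Diff)

lemma m_mono: "W \<in> \<A> \<Longrightarrow> W' \<in> \<A> \<Longrightarrow> W' \<subseteq> W \<Longrightarrow> m W' \<le> m W"
  using m_Diff[of W W'] nonneg[of "W - W'"] by (simp add: \<A>.Diff)

lemma m_subadditive: "W \<in> \<A> \<Longrightarrow> W' \<in> \<A> \<Longrightarrow> m (W \<union> W') \<le> m W + m W'"
  using additive[of W "W' - W"] m_mono[of W' "W' - W"] by (simp add: \<A>.Diff)

text \<open>The assumed upper bound, applied to the complement, turns into the lower bound because
  the total mass is 1.\<close>

lemma snd_marginal_eq:
  assumes V: "V \<in> continuity_sets \<nu>" shows "m (UNIV \<times> V) = measure \<nu> V"
proof (rule antisym[OF snd_marginal[OF V]])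
  have cV: "- V \<in> continuity_sets \<nu>" by (rule S.continuity_sets_Compl[OF V])
  have "m (UNIV \<times> V \<union> UNIV \<times> - V) = m (UNIV \<times> V) + m (UNIV \<times> - V)"
    by (intro additive section_algebra_Times V cV) auto
  also have "UNIV \<times> V \<union> UNIV \<times> - V = UNIV \<times> UNIV" by auto
  also have "m (UNIV \<times> UNIV) = 1" using fst_marginal[of UNIV] E.prob_space by simp
  finally have "1 \<le> m (UNIV \<times> V) + measure \<nu> (- V)" using snd_marginal[OF cV] by linarith
  moreover have "measure \<nu> (- V) = 1 - measure \<nu> V"
    using S.prob_compl[of V] S.continuity_sets_borel[OF V] S.sets_eq by (simp add: Compl_eq_Diff_UNIV)
  ultimately show "measure \<nu> V \<le> m (UNIV \<times> V)" by simp
qed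

text \<open>Each of the finitely many sections is shrunk separately. What is lost lies over the
  union B of the lost parts, and its content is controlled by the second marginal alone; the first
  coordinate is left untouched.\<close>

lemma inner_approx:
  assumes W: "W \<in> \<A>" and \<delta>: "\<delta> > 0" and r: "r > 0"
  shows "\<exists>W'\<in>\<A>. W' \<subseteq> W \<and> m (W - W') \<le> \<delta> \<and> (\<forall>x. closed (Pair x -` W')) \<and>
    (\<forall>x. \<exists>F. finite F \<and> Pair x -` W' \<subseteq> (\<Union>y\<in>F. cball y r))"
proof -
  let ?s = "\<lambda>x. Pair x -` W"
  have sf: "simple_function \<eta> ?s" and cs: "\<And>x. ?s x \<in> continuity_sets \<nu>"
    using W unfolding section_algebra_def by auto
  have fin: "finite (range ?s)" using simple_functionD(1)[OF sf] by simp
  \<comment> \<open>Each of the k sections may lose mass \<delta>/k.\<close>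
  define k where "k = card (range ?s)"
  have k: "k > 0" unfolding k_def using fin by (simp add: card_gt_0_iff)
  have ex: "\<forall>V\<in>continuity_sets \<nu>. \<exists>V'. V' \<in> continuity_sets \<nu> \<and> closed V' \<and> V' \<subseteq> V \<and>
      measure \<nu> (V - V') < \<delta> / k \<and> (\<exists>F. finite F \<and> V' \<subseteq> (\<Union>y\<in>F. cball y r))"
  proof
    fix V assume V: "V \<in> continuity_sets \<nu>"
    have "\<delta> / k > 0" using \<delta> k by simp
    from S.continuity_set_inner_approx[OF V this r]
    obtain V' F where "V' \<in> continuity_sets \<nu>" "closed V'" "V' \<subseteq> V" "measure \<nu> (V - V') < \<delta> / k"
      "finite F" "V' \<subseteq> (\<Union>y\<in>F. cball y r)" .
    then show "\<exists>V'. V' \<in> continuity_sets \<nu> \<and> closed V' \<and> V' \<subseteq> V \<and>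
      measure \<nu> (V - V') < \<delta> / k \<and> (\<exists>F. finite F \<and> V' \<subseteq> (\<Union>y\<in>F. cball y r))"
      by (intro exI[of _ V'] conjI exI[of _ F])
  qed
  \<comment> \<open>The shrunken set depends on the section only and not on x, so the section map of
    W' factors through that of W and stays simple.\<close>
  from bchoice[OF ex] obtain \<tau> where "\<forall>V\<in>continuity_sets \<nu>. \<tau> V \<in> continuity_sets \<nu> \<and> closed (\<tau> V) \<and> \<tau> V \<subseteq> V \<and>
      measure \<nu> (V - \<tau> V) < \<delta> / k \<and> (\<exists>F. finite F \<and> \<tau> V \<subseteq> (\<Union>y\<in>F. cball y r))"
    by (rule exE)
  then have \<tau>: "\<And>V. V \<in> continuity_sets \<nu> \<Longrightarrow> \<tau> V \<in> continuity_sets \<nu>"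
    "\<And>V. V \<in> continuity_sets \<nu> \<Longrightarrow> closed (\<tau> V)"
    "\<And>V. V \<in> continuity_sets \<nu> \<Longrightarrow> \<tau> V \<subseteq> V"
    "\<And>V. V \<in> continuity_sets \<nu> \<Longrightarrow> measure \<nu> (V - \<tau> V) < \<delta> / k"
    "\<And>V. V \<in> continuity_sets \<nu> \<Longrightarrow> \<exists>F. finite F \<and> \<tau> V \<subseteq> (\<Union>y\<in>F. cball y r)"
    by simp_all
  define W' where "W' = {(x, y). y \<in> \<tau> (?s x)}"
  have sec: "Pair x -` W' = \<tau> (?s x)" for x unfolding W'_def by auto
  have W'A: "W' \<in> \<A>"
    unfolding section_algebra_def using sec \<tau>(1) cs simple_function_compose1[OF sf, of \<tau>] by simp
  have sub: "W' \<subseteq> W" unfolding W'_def using \<tau>(3)[OF cs] by auto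
  interpret cs: algebra UNIV "continuity_sets \<nu>" by (rule S.continuity_sets_algebra)
  define B where "B = (\<Union>V\<in>range ?s. V - \<tau> V)"
  have Bcs: "B \<in> continuity_sets \<nu>"
    unfolding B_def using fin cs \<tau>(1) by (intro cs.finite_UN) auto
  have "W - W' \<subseteq> UNIV \<times> B" unfolding W'_def B_def by auto
  then have "m (W - W') \<le> m (UNIV \<times> B)"
    by (intro m_mono section_algebra_Times Bcs) (auto intro: W W'A)
  also have "\<dots> \<le> measure \<nu> B" by (rule snd_marginal[OF Bcs])
  also have "\<dots> \<le> (\<Sum>V\<in>range ?s. measure \<nu> (V - \<tau> V))"
    unfolding B_def using fin cs \<tau>(1) S.sets_eq
    by (intro measure_UNION_le) (auto intro!: sets.Diff S.continuity_sets_borel)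
  also have "\<dots> \<le> (\<Sum>V\<in>range ?s. \<delta> / k)"
    using cs \<tau>(4) by (intro sum_mono less_imp_le) auto
  also have "\<dots> = \<delta>" using k unfolding k_def by simp
  finally have "m (W - W') \<le> \<delta>" .
  moreover have "\<forall>x. closed (Pair x -` W')" using sec \<tau>(2)[OF cs] by simp
  moreover have "\<forall>x. \<exists>F. finite F \<and> Pair x -` W' \<subseteq> (\<Union>y\<in>F. cball y r)"
    using sec \<tau>(5)[OF cs] by simp
  ultimately show ?thesis using W'A sub by blast
qed

text \<open>The compactness argument is confined to one fibre. After shrinking, the intersections C
  n still have content at least \<epsilon>/2, so their projections have \<eta>-measure at least
  \<epsilon>/2. Countable additivity of \<eta> yields a point x common to all projections, and over
  x the sections of the C n are nested, closed, nonempty and covered by finitely many balls of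
  radius 1/(n+1).\<close>

lemma decseq_nonempty:
  assumes A: "range A \<subseteq> \<A>" "decseq A" and \<epsilon>: "\<epsilon> > 0" and lower: "\<And>n. \<epsilon> \<le> m (A n)"
  shows "(\<Inter>n. A n) \<noteq> {}"
proof -
  \<comment> \<open>The errors \<epsilon>/4, \<epsilon>/8, ... add up to \<epsilon>/2, so half of
    the content survives all the shrinkings.\<close>
  have "\<exists>W'\<in>\<A>. W' \<subseteq> A n \<and> m (A n - W') \<le> \<epsilon> / 2 ^ (n + 2) \<and> (\<forall>x. closed (Pair x -` W')) \<and>
    (\<forall>x. \<exists>F. finite F \<and> Pair x -` W' \<subseteq> (\<Union>y\<in>F. cball y (1 / Suc n)))" for n
    by (rule inner_approx) (use A \<epsilon> in auto)
  then obtain W where W: "\<And>n. W n \<in> \<A>" "\<And>n. W n \<subseteq> A n" "\<And>n. m (A n - W n) \<le> \<epsilon> / 2 ^ (n + 2)"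
    "\<And>n x. closed (Pair x -` W n)"
    "\<And>n x. \<exists>F. finite F \<and> Pair x -` W n \<subseteq> (\<Union>y\<in>F. cball y (1 / Suc n))"
    by metis
  define C where "C n = (\<Inter>i\<le>n. W i)" for n
  have CA: "C n \<in> \<A>" for n unfolding C_def by (intro \<A>.finite_INT) (auto simp: W)
  have AA: "A n \<in> \<A>" for n using A by auto
  have CSuc: "C (Suc n) = C n \<inter> W (Suc n)" for n unfolding C_def by (auto simp: atMost_Suc)
  have C_sub: "C n \<subseteq> W n" for n unfolding C_def by auto
  have decC: "decseq C" unfolding decseq_Suc_iff by (simp add: CSuc)
  \<comment> \<open>The right-hand side is the sum of the first n + 1 errors.\<close>
  have "m (A n - C n) \<le> \<epsilon> / 2 * (1 - 1 / 2 ^ (n + 1))" for n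
  proof (induction n)
    case 0
    then show ?case using W(3)[of 0] by (simp add: C_def)
  next
    case (Suc n)
    have "A (Suc n) \<subseteq> A n" using A(2) by (simp add: decseq_Suc_iff)
    then have "A (Suc n) - C (Suc n) \<subseteq> (A n - C n) \<union> (A (Suc n) - W (Suc n))"
      by (auto simp: CSuc)
    then have "m (A (Suc n) - C (Suc n)) \<le> m ((A n - C n) \<union> (A (Suc n) - W (Suc n)))"
      by (intro m_mono \<A>.Un \<A>.Diff AA CA W)
    also have "\<dots> \<le> m (A n - C n) + m (A (Suc n) - W (Suc n))"
      by (intro m_subadditive \<A>.Diff AA CA W)
    also have "\<dots> \<le> \<epsilon> / 2 * (1 - 1 / 2 ^ (n + 1)) + \<epsilon> / 2 ^ (Suc n + 2)"
      by (intro add_mono Suc.IH W(3))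
    also have "\<dots> = \<epsilon> / 2 * (1 - 1 / 2 ^ (Suc n + 1))" by (simp add: field_simps)
    finally show ?case .
  qed
  moreover have "\<epsilon> / 2 * (1 - 1 / 2 ^ (n + 1)) \<le> \<epsilon> / 2" for n :: nat
    using \<epsilon> by (intro mult_left_le) auto
  ultimately have diff: "m (A n - C n) \<le> \<epsilon> / 2" for n by (rule order_trans)
  have C_lower: "\<epsilon> / 2 \<le> m (C n)" for n
  proof -
    have "m (A n) = m (C n) + m (A n - C n)"
      using C_sub[of n] W(2)[of n] by (intro m_Diff AA CA) auto
    then show ?thesis using lower[of n] diff[of n] by simp
  qed
  \<comment> \<open>The projection of C n to E. It is measurable because the section map of C n is
    simple; no theorem on measurable projections is involved.\<close>
  define P where "P n = {x. Pair x -` C n \<noteq> {}}" for n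
  have Pm: "P n \<in> sets borel" for n
  proof -
    have "simple_function \<eta> (\<lambda>x. Pair x -` C n)" using CA[of n] unfolding section_algebra_def by auto
    from simple_functionD(2)[OF this, of "- {{}}"] show ?thesis
      using E.sets_eq by (simp add: P_def vimage_def)
  qed
  have P_lower: "\<epsilon> / 2 \<le> measure \<eta> (P n)" for n
  proof -
    have "C n \<subseteq> P n \<times> UNIV" unfolding P_def by auto
    moreover have "P n \<times> UNIV \<in> \<A>"
      using Pm \<A>.top S.continuity_sets_Compl[OF S.continuity_sets_empty]
      by (intro section_algebra_Times) auto
    ultimately have "m (C n) \<le> m (P n \<times> UNIV)" by (intro m_mono CA)
    then show ?thesis using C_lower[of n] fst_marginal[OF Pm, of n] by simp
  qed
  have "decseq P"
    using decC unfolding decseq_def P_def by blast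
  then have "(\<lambda>n. measure \<eta> (P n)) \<longlonglongrightarrow> measure \<eta> (\<Inter>n. P n)"
    using Pm E.sets_eq by (intro E.finite_Lim_measure_decseq) auto
  then have "\<epsilon> / 2 \<le> measure \<eta> (\<Inter>n. P n)"
    by (rule LIMSEQ_le_const) (use P_lower in auto)
  then have "(\<Inter>n. P n) \<noteq> {}" using \<epsilon> by (auto simp del: INT_iff)
  then obtain x where x: "\<And>n. Pair x -` C n \<noteq> {}" unfolding P_def by blast
  have "(\<Inter>n. Pair x -` C n) \<noteq> {}"
  proof (rule nested_closed_totally_bounded)
    show "closed (Pair x -` C n)" for n
      unfolding C_def vimage_INT by (intro closed_INT ballI W(4))
    show "Pair x -` C n \<noteq> {}" for n by (rule x)
    show "decseq (\<lambda>n. Pair x -` C n)" using decC unfolding decseq_def by (auto intro!: vimage_mono)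
    show "\<exists>F. finite F \<and> Pair x -` C n \<subseteq> (\<Union>y\<in>F. cball y (1 / Suc n))" for n
      using W(5)[of x n] vimage_mono[OF C_sub[of n], of "Pair x"] by (meson order_trans)
  qed
  then obtain y where "\<And>n. (x, y) \<in> C n" by auto
  then have "(x, y) \<in> A n" for n using C_sub[of n] W(2)[of n] by blast
  then show ?thesis by blast
qed

text \<open>Caratheodory's extension theorem asks for continuity at the empty set, which is the
  contrapositive of \<open>decseq_nonempty\<close>. The first marginal is read off from the
  rectangles U x UNIV for every Borel U; for the second only continuity sets are available, and they
  form an intersection-stable generator of the Borel sets.\<close>

theorem extension_to_coupling:
  obtains \<gamma> where "\<gamma> \<in> couplings \<eta> \<nu>" "\<And>W. W \<in> \<A> \<Longrightarrow> measure \<gamma> W = m W"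
proof -
  have "\<exists>\<mu>. (\<forall>s\<in>\<A>. \<mu> s = ennreal (m s)) \<and> measure_space UNIV (sigma_sets UNIV \<A>) \<mu>"
  proof (rule \<A>.caratheodory_empty_continuous)
    show "positive \<A> (\<lambda>W. ennreal (m W))" by (simp add: positive_def m_empty)
    show "additive \<A> (\<lambda>W. ennreal (m W))"
      unfolding additive_def using additive nonneg by (simp add: ennreal_plus)
    show "ennreal (m W) \<noteq> \<infinity>" for W by simp
    fix A :: "nat \<Rightarrow> ('e \<times> 's) set" assume A: "range A \<subseteq> \<A>" "decseq A" "(\<Inter>i. A i) = {}"
    have "(\<lambda>i. m (A i)) \<longlonglongrightarrow> 0"
    proof (rule LIMSEQ_I)
      fix r :: real assume r: "r > 0"
      obtain N where N: "m (A N) < r"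
        using decseq_nonempty[OF A(1,2) r] A(3) by (meson not_less)
      have "norm (m (A n) - 0) < r" if "n \<ge> N" for n
      proof -
        have "A k \<in> \<A>" for k using A(1) by blast
        then show ?thesis using m_mono[of "A N" "A n"] decseqD[OF A(2) that] N nonneg[of "A n"] by simp
      qed
      then show "\<exists>N. \<forall>n\<ge>N. norm (m (A n) - 0) < r" by blast
    qed
    then show "(\<lambda>i. ennreal (m (A i))) \<longlonglongrightarrow> 0" using tendsto_ennrealI by fastforce
  qed
  then obtain \<mu> where \<mu>: "\<And>W. W \<in> \<A> \<Longrightarrow> \<mu> W = ennreal (m W)"
    "measure_space UNIV (sigma_sets UNIV \<A>) \<mu>" by blast
  define \<gamma> where "\<gamma> = measure_of UNIV \<A> \<mu>"
  have sets_\<gamma>: "sets \<gamma> = sets borel"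
    unfolding \<gamma>_def by (simp add: sigma_sets_section_algebra)
  have em: "emeasure \<gamma> W = ennreal (m W)" if "W \<in> \<A>" for W
    using emeasure_measure_of[OF \<gamma>_def, of W] \<mu> that
    by (simp add: sets_\<gamma> sigma_sets_section_algebra section_algebra_borel measure_space_def)
  have me: "measure \<gamma> W = m W" if "W \<in> \<A>" for W
    using em[OF that] nonneg[OF that] by (simp add: measure_def)
  have space_\<gamma>: "space \<gamma> = UNIV" using sets_eq_imp_space_eq[OF sets_\<gamma>] by simp
  have "m UNIV = 1" using fst_marginal[of UNIV] E.prob_space by simp
  then interpret G: prob_space \<gamma>
    by (intro prob_spaceI) (simp add: space_\<gamma> em)
  have UNIV_cs: "UNIV \<in> continuity_sets \<nu>"
    using S.continuity_sets_Compl[OF S.continuity_sets_empty] by simp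
  have fst_m: "fst \<in> borel_measurable \<gamma>" and snd_m: "snd \<in> borel_measurable \<gamma>"
    unfolding measurable_cong_sets[OF sets_\<gamma> refl]
    by (intro borel_measurable_continuous_onI continuous_intros)+
  have "distr \<gamma> borel fst = \<eta>"
  proof (rule measure_eqI)
    show "sets (distr \<gamma> borel fst) = sets \<eta>" using E.sets_eq by simp
    fix U assume "U \<in> sets (distr \<gamma> borel fst)"
    then have U: "U \<in> sets borel" by simp
    have "fst -` U \<inter> space \<gamma> = U \<times> UNIV" by (auto simp: space_\<gamma>)
    then show "emeasure (distr \<gamma> borel fst) U = emeasure \<eta> U"
      using U fst_m em[OF section_algebra_Times[OF U UNIV_cs]] fst_marginal[OF U]
      by (simp add: emeasure_distr E.emeasure_eq_measure)
  qed
  moreover have "distr \<gamma> borel snd = \<nu>"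
  proof -
    interpret cs: algebra UNIV "continuity_sets \<nu>" by (rule S.continuity_sets_algebra)
    obtain B where B: "countable B" "topological_basis B" "B \<subseteq> continuity_sets \<nu>"
      by (rule S.continuity_basis)
    have "sets borel = sigma_sets UNIV B"
      unfolding borel_eq_countable_basis[OF B(1,2)] by (rule sets_measure_of) simp
    then have "sets borel \<subseteq> sigma_sets UNIV (continuity_sets \<nu>)"
      using sigma_sets_mono'[OF B(3), of UNIV] by simp
    moreover have "sigma_sets UNIV (continuity_sets \<nu>) \<subseteq> sets borel"
      by (intro borel_sigma_sets_subset subsetI S.continuity_sets_borel)
    ultimately have gen: "sets borel = sigma_sets UNIV (continuity_sets \<nu>)" by blast
    show ?thesis
    proof (rule measure_eqI_generator_eq[where E="continuity_sets \<nu>" and \<Omega>=UNIV and A="\<lambda>_. UNIV"])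
      show "Int_stable (continuity_sets \<nu>)" unfolding Int_stable_def by auto
      show "emeasure (distr \<gamma> borel snd) V = emeasure \<nu> V" if V: "V \<in> continuity_sets \<nu>" for V
      proof -
        have "snd -` V \<inter> space \<gamma> = UNIV \<times> V" by (auto simp: space_\<gamma>)
        then show ?thesis
          using snd_m em[OF section_algebra_Times[OF _ V, of UNIV]] snd_marginal_eq[OF V]
            S.continuity_sets_borel[OF V]
          by (simp add: emeasure_distr S.emeasure_eq_measure)
      qed
      show "emeasure (distr \<gamma> borel snd) UNIV \<noteq> \<infinity>" for i :: nat
        using snd_m by (simp add: emeasure_distr G.emeasure_eq_measure)
    qed (use gen S.sets_eq UNIV_cs in auto)
  qed
  ultimately have "\<gamma> \<in> couplings \<eta> \<nu>"
    unfolding couplings_def borel_probs_def using sets_\<gamma> G.prob_space_axioms by simp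
  then show thesis using me that by blast
qed

end

section \<open>Integration and weak duality\<close>

lemma prob_space_completion: "prob_space M \<Longrightarrow> prob_space (completion M)"
  by (intro prob_spaceI) (simp add: prob_space.emeasure_space_1)

lemma Linfty_measurable: "f \<in> Linfty M \<Longrightarrow> f \<in> borel_measurable (completion M)"
  unfolding Linfty_def by simp

lemma Linfty_bound:
  assumes "f \<in> Linfty M" obtains C where "C \<ge> 0" "AE x in completion M. \<bar>f x\<bar> \<le> C"
proof -
  obtain C where "AE x in completion M. \<bar>f x\<bar> \<le> C" using assms unfolding Linfty_def by auto
  then have "AE x in completion M. \<bar>f x\<bar> \<le> max 0 C" by eventually_elim simp
  then show thesis using that[of "max 0 C"] by simp
qed

lemma Linfty_const: "(\<lambda>_. c) \<in> Linfty M"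
  unfolding Linfty_def by auto

lemma Linfty_add:
  assumes "f \<in> Linfty M" "g \<in> Linfty M" shows "(\<lambda>x. f x + g x) \<in> Linfty M"
proof -
  obtain C D where "AE x in completion M. \<bar>f x\<bar> \<le> C" "AE x in completion M. \<bar>g x\<bar> \<le> D"
    using assms unfolding Linfty_def by auto
  then have "AE x in completion M. \<bar>f x + g x\<bar> \<le> C + D" by eventually_elim linarith
  then show ?thesis using assms unfolding Linfty_def by auto
qed

lemma Linfty_scale:
  assumes "f \<in> Linfty M" shows "(\<lambda>x. t * f x) \<in> Linfty M"
proof -
  obtain C where "AE x in completion M. \<bar>f x\<bar> \<le> C" using assms unfolding Linfty_def by auto
  then have "AE x in completion M. \<bar>t * f x\<bar> \<le> \<bar>t\<bar> * C"
    by eventually_elim (simp add: abs_mult mult_left_mono)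
  then show ?thesis using assms unfolding Linfty_def by auto
qed

lemma Linfty_abs: "f \<in> Linfty M \<Longrightarrow> (\<lambda>x. \<bar>f x\<bar>) \<in> Linfty M"
  unfolding Linfty_def by auto

lemma Linfty_sum: "(\<And>i. i \<in> I \<Longrightarrow> f i \<in> Linfty M) \<Longrightarrow> (\<lambda>x. \<Sum>i\<in>I. f i x) \<in> Linfty M"
  by (induction I rule: infinite_finite_induct) (auto intro: Linfty_const Linfty_add)

lemma Linfty_borel: "f \<in> borel_measurable M \<Longrightarrow> (\<And>x. \<bar>f x\<bar> \<le> C) \<Longrightarrow> f \<in> Linfty M"
  unfolding Linfty_def by (auto intro: measurable_completion)

lemma Linfty_integrable:
  assumes "prob_space M" "f \<in> Linfty M" shows "integrable (completion M) f"
proof -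
  interpret C: prob_space "completion M" by (rule prob_space_completion[OF assms(1)])
  obtain C where "AE x in completion M. \<bar>f x\<bar> \<le> C" using assms(2) unfolding Linfty_def by auto
  then show ?thesis
    using Linfty_measurable[OF assms(2)] by (intro C.integrable_const_bound[of f C]) auto
qed

text \<open>A completion-measurable function agrees almost everywhere with a measurable one for the
  original sigma-field; truncating the latter at the essential bound makes it bounded at every point
  and alters it only on a null set.\<close>

lemma Linfty_AE_bounded_borel:
  assumes "f \<in> Linfty M"
  obtains f' C where "f' \<in> borel_measurable M" "\<And>x. \<bar>f' x\<bar> \<le> C" "AE x in completion M. f x = f' x"
proof -
  obtain C where C: "C \<ge> 0" "AE x in completion M. \<bar>f x\<bar> \<le> C" by (rule Linfty_bound[OF assms])
  obtain f' where f': "f' \<in> borel_measurable M" "AE x in M. f x = f' x"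
    using completion_ex_borel_measurable_real[OF Linfty_measurable[OF assms]] by blast
  have "AE x in completion M. f x = f' x" by (rule AE_completion[OF f'(2)])
  with C(2) have "AE x in completion M. f x = max (- C) (min C (f' x))"
    by eventually_elim auto
  moreover have "(\<lambda>x. max (- C) (min C (f' x))) \<in> borel_measurable M" using f'(1) by measurable
  moreover have "\<bar>max (- C) (min C (f' x))\<bar> \<le> C" for x using C(1) by auto
  ultimately show thesis using that by blast
qed

section \<open>Bounded continuous functions\<close>

lemma bcontfun_bound:
  fixes g :: "'a::topological_space \<Rightarrow> real"
  assumes "g \<in> bcontfun" obtains C where "\<And>x. \<bar>g x\<bar> \<le> C"
proof -
  obtain C where "\<forall>x\<in>range g. norm x \<le> C" using assms unfolding bcontfun_def bounded_iff by auto
  then have "\<bar>g x\<bar> \<le> C" for x by simp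
  then show thesis by (rule that)
qed

lemma bcontfun_continuous: "g \<in> bcontfun \<Longrightarrow> continuous_on UNIV g"
  unfolding bcontfun_def by simp

lemma (in borel_prob) bcontfun_integrable:
  fixes g :: "'a \<Rightarrow> real"
  assumes "g \<in> bcontfun" shows "integrable \<nu> g"
proof -
  obtain C where "\<And>x. \<bar>g x\<bar> \<le> C" using bcontfun_bound[OF assms] by metis
  moreover have "g \<in> borel_measurable \<nu>"
    unfolding measurable_cong_sets[OF sets_eq refl]
    by (intro borel_measurable_continuous_onI bcontfun_continuous assms)
  ultimately show ?thesis by (intro integrable_const_bound[of g C]) auto
qed

lemma bcontfun_add_real:
  fixes f g :: "'a::topological_space \<Rightarrow> real"
  assumes "f \<in> bcontfun" "g \<in> bcontfun" shows "(\<lambda>x. f x + g x) \<in> bcontfun"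
proof -
  obtain C D where "\<And>x. \<bar>f x\<bar> \<le> C" "\<And>x. \<bar>g x\<bar> \<le> D" using bcontfun_bound assms by metis
  then have "\<bar>f x + g x\<bar> \<le> C + D" for x
    by (meson abs_triangle_ineq add_mono order_trans)
  then show ?thesis using assms unfolding bcontfun_def bounded_iff by (auto intro!: continuous_intros)
qed

lemma bcontfun_scale_real:
  fixes g :: "'a::topological_space \<Rightarrow> real"
  assumes "g \<in> bcontfun" shows "(\<lambda>x. t * g x) \<in> bcontfun"
proof -
  obtain C where "\<And>x. \<bar>g x\<bar> \<le> C" using bcontfun_bound assms by metis
  then have "\<bar>t * g x\<bar> \<le> \<bar>t\<bar> * C" for x by (simp add: abs_mult mult_left_mono)
  then show ?thesis using assms unfolding bcontfun_def bounded_iff by (auto intro!: continuous_intros)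
qed

lemma bcontfun_const_real: "(\<lambda>_. c :: real) \<in> bcontfun"
  by (rule const_bcontfun)

section \<open>Functions of one coordinate under a coupling\<close>

context
  fixes \<gamma> :: "('e::second_countable_topology \<times> 's::second_countable_topology) measure" and \<eta> \<nu>
  assumes \<gamma>: "\<gamma> \<in> couplings \<eta> \<nu>"
begin

lemma coupling_prob_space: "prob_space \<gamma>"
  and coupling_sets: "sets \<gamma> = sets borel"
  and coupling_fst: "distr \<gamma> borel fst = \<eta>"
  and coupling_snd: "distr \<gamma> borel snd = \<nu>"
  using \<gamma> unfolding couplings_def borel_probs_def by auto

lemma coupling_space: "space \<gamma> = UNIV"
  using sets_eq_imp_space_eq[OF coupling_sets] by simp

lemma coupling_fst_measurable: "fst \<in> borel_measurable \<gamma>"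
  and coupling_snd_measurable: "snd \<in> borel_measurable \<gamma>"
  unfolding measurable_cong_sets[OF coupling_sets refl]
  by (intro borel_measurable_continuous_onI continuous_intros)+

lemma coupling_borel_prob: "borel_prob \<eta>" "borel_prob \<nu>"
  using prob_space.prob_space_distr[OF coupling_prob_space coupling_fst_measurable]
    prob_space.prob_space_distr[OF coupling_prob_space coupling_snd_measurable]
    coupling_fst coupling_snd
  unfolding borel_prob_def borel_prob_axioms_def by (metis sets_distr)+

text \<open>The preimage of an \<eta>-null set under \<open>fst\<close> is \<gamma>-null because the
  first marginal is \<eta>. This is what allows functions in \<open>Linfty \<eta>\<close> to be
  integrated against the completed coupling.\<close>

lemma coupling_fst_completion: "fst \<in> completion \<gamma> \<rightarrow>\<^sub>M completion \<eta>"
  and coupling_distr_fst_completion: "distr (completion \<gamma>) (completion \<eta>) fst = completion \<eta>"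
proof -
  have sets_\<eta>: "sets \<eta> = sets borel" using coupling_fst sets_distr by metis
  have m: "fst \<in> \<gamma> \<rightarrow>\<^sub>M \<eta>"
    unfolding measurable_cong_sets[OF refl sets_\<eta>] by (rule coupling_fst_measurable)
  have "distr (completion \<gamma>) \<eta> fst = distr \<gamma> \<eta> fst" by (rule distr_completion[OF m])
  also have "\<dots> = distr \<gamma> borel fst" by (rule distr_cong) (simp_all add: sets_\<eta>)
  finally have eq: "distr (completion \<gamma>) \<eta> fst = \<eta>" by (simp add: coupling_fst)
  have m': "fst \<in> completion \<gamma> \<rightarrow>\<^sub>M \<eta>" by (rule measurable_completion[OF m])
  show "fst \<in> completion \<gamma> \<rightarrow>\<^sub>M completion \<eta>"
    by (rule completion.measurable_completion2[OF m']) (simp add: eq)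
  show "distr (completion \<gamma>) (completion \<eta>) fst = completion \<eta>"
    using completion.completion_distr_eq[OF m'] eq by simp
qed

lemma coupling_Linfty_measurable:
  "f \<in> Linfty \<eta> \<Longrightarrow> (\<lambda>z. f (fst z)) \<in> borel_measurable (completion \<gamma>)"
  using measurable_comp[OF coupling_fst_completion Linfty_measurable] by (simp add: comp_def)

lemma coupling_Linfty_integrable:
  assumes f: "f \<in> Linfty \<eta>" shows "integrable (completion \<gamma>) (\<lambda>z. f (fst z))"
proof -
  have "prob_space \<eta>" using coupling_borel_prob unfolding borel_prob_def by simp
  then have "integrable (distr (completion \<gamma>) (completion \<eta>) fst) f"
    unfolding coupling_distr_fst_completion by (rule Linfty_integrable[OF _ f])
  then show ?thesis by (rule integrable_distr[OF coupling_fst_completion])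
qed

lemma coupling_Linfty_integral:
  assumes f: "f \<in> Linfty \<eta>" shows "(\<integral>z. f (fst z) \<partial>completion \<gamma>) = (\<integral>x. f x \<partial>completion \<eta>)"
  using integral_distr[OF coupling_fst_completion Linfty_measurable[OF f]]
  by (simp add: coupling_distr_fst_completion)

lemma coupling_AE_fst:
  assumes "AE x in completion \<eta>. P x" shows "AE z in completion \<gamma>. P (fst z)"
  by (rule AE_distrD[OF coupling_fst_completion, of P])
    (use assms in \<open>simp only: coupling_distr_fst_completion\<close>)

lemma coupling_bcontfun:
  fixes g :: "'s \<Rightarrow> real"
  assumes g: "g \<in> bcontfun"
  shows "integrable (completion \<gamma>) (\<lambda>z. g (snd z))"
    and "(\<integral>z. g (snd z) \<partial>completion \<gamma>) = (\<integral>y. g y \<partial>\<nu>)"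
proof -
  have gm: "g \<in> borel_measurable borel"
    by (intro borel_measurable_continuous_onI bcontfun_continuous g)
  have m: "(\<lambda>z. g (snd z)) \<in> borel_measurable \<gamma>"
    by (rule measurable_compose[OF coupling_snd_measurable gm])
  have "integrable (distr \<gamma> borel snd) g"
    unfolding coupling_snd by (rule borel_prob.bcontfun_integrable[OF coupling_borel_prob(2) g])
  then have "integrable \<gamma> (\<lambda>z. g (snd z))" by (rule integrable_distr[OF coupling_snd_measurable])
  then show "integrable (completion \<gamma>) (\<lambda>z. g (snd z))" by (simp add: integrable_completion m)
  show "(\<integral>z. g (snd z) \<partial>completion \<gamma>) = (\<integral>y. g y \<partial>\<nu>)"
    using integral_distr[OF coupling_snd_measurable gm] integral_completion[OF m]
    by (simp add: coupling_snd)
qed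

end

text \<open>The nonnegative integral is monotone on arbitrary functions, so u can be any function
  above F. Its negative part is below that of F and thus has a finite integral, which makes the
  difference meaningful.\<close>

lemma ereal_integral_ge:
  assumes F: "integrable M F" and le: "\<And>z. ereal (F z) \<le> u z"
  shows "ereal (\<integral>z. F z \<partial>M) \<le> ereal_integral M u"
proof -
  have 1: "(\<integral>\<^sup>+ z. ennreal (F z) \<partial>M) \<le> (\<integral>\<^sup>+ z. e2ennreal (u z) \<partial>M)"
    using le by (intro nn_integral_mono) (metis e2ennreal_ereal e2ennreal_mono)
  have 2: "(\<integral>\<^sup>+ z. e2ennreal (- u z) \<partial>M) \<le> (\<integral>\<^sup>+ z. ennreal (- F z) \<partial>M)"
    using le by (intro nn_integral_mono)
      (metis e2ennreal_ereal e2ennreal_mono ereal_minus_le_minus uminus_ereal.simps(1))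
  obtain r q where rq: "0 \<le> r" "0 \<le> q" "(\<integral>\<^sup>+ z. ennreal (F z) \<partial>M) = ennreal r"
    "(\<integral>\<^sup>+ z. ennreal (- F z) \<partial>M) = ennreal q" "(\<integral>z. F z \<partial>M) = r - q"
    by (rule integrableE[OF F]) auto
  have "ereal (\<integral>z. F z \<partial>M) = enn2ereal (\<integral>\<^sup>+ z. ennreal (F z) \<partial>M) - enn2ereal (\<integral>\<^sup>+ z. ennreal (- F z) \<partial>M)"
    using rq by simp
  also have "\<dots> \<le> ereal_integral M u"
    unfolding ereal_integral_def using 1 2
    by (intro ereal_minus_mono) (simp_all add: less_eq_ennreal.rep_eq)
  finally show ?thesis .
qed

lemma ereal_integral_eq:
  assumes F: "integrable M F" and eq: "AE z in M. u z = ereal (F z)"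
  shows "ereal_integral M u = ereal (\<integral>z. F z \<partial>M)"
proof -
  have 1: "(\<integral>\<^sup>+ z. e2ennreal (u z) \<partial>M) = (\<integral>\<^sup>+ z. ennreal (F z) \<partial>M)"
    using eq by (intro nn_integral_cong_AE) (auto simp: e2ennreal_ereal)
  have 2: "(\<integral>\<^sup>+ z. e2ennreal (- u z) \<partial>M) = (\<integral>\<^sup>+ z. ennreal (- F z) \<partial>M)"
    using eq by (intro nn_integral_cong_AE) (auto simp: e2ennreal_ereal)
  obtain r q where rq: "0 \<le> r" "0 \<le> q" "(\<integral>\<^sup>+ z. ennreal (F z) \<partial>M) = ennreal r"
    "(\<integral>\<^sup>+ z. ennreal (- F z) \<partial>M) = ennreal q" "(\<integral>z. F z \<partial>M) = r - q"
    by (rule integrableE[OF F]) auto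
  then show ?thesis unfolding ereal_integral_def 1 2 by simp
qed

lemma weak_duality:
  fixes c :: "'e::second_countable_topology \<times> 's::second_countable_topology \<Rightarrow> ereal"
  shows "dual_value c h \<eta> \<nu> \<le> primal_value c h \<eta> \<nu>"
  unfolding dual_value_def primal_value_def
proof (intro Sup_least Inf_greatest, elim CollectE exE conjE)
  fix a b f and g :: "'s \<Rightarrow> real" and \<gamma>
  assume *: "a = ereal ((\<integral>x. f x \<partial>completion \<eta>) + (\<integral>y. g y \<partial>\<nu>))" "f \<in> Linfty \<eta>" "g \<in> bcontfun"
    "\<forall>x y. ereal (f x + g y) \<le> c (x, y) + ereal (h (x, y))"
    and \<gamma>: "b = ereal_integral (completion \<gamma>) (\<lambda>z. c z + ereal (h z))" "\<gamma> \<in> couplings \<eta> \<nu>"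
  let ?F = "\<lambda>z. f (fst z) + g (snd z)"
  note int = coupling_Linfty_integrable[OF \<gamma>(2) *(2)] coupling_bcontfun[OF \<gamma>(2) *(3)]
  have "a = ereal (\<integral>z. ?F z \<partial>completion \<gamma>)"
    using int coupling_Linfty_integral[OF \<gamma>(2) *(2)] *(1) by simp
  also have "\<dots> \<le> b"
    unfolding \<gamma>(1) using int *(4) by (intro ereal_integral_ge) auto
  finally show "a \<le> b" .
qed

section \<open>Couplings from positive functionals\<close>

text \<open>The space on which the functional will act. The bound is a function of x rather than a
  constant because the coefficients of h are only essentially bounded, so that h may be
  unbounded.\<close>

definition Linfty_dominated :: "'e measure \<Rightarrow> ('e \<times> 's \<Rightarrow> real) set" where
  "Linfty_dominated \<eta> = {u. \<exists>f\<in>Linfty \<eta>. \<forall>x y. \<bar>u (x, y)\<bar> \<le> f x}"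

lemma Linfty_dominatedI:
  "f \<in> Linfty \<eta> \<Longrightarrow> (\<And>x y. \<bar>u (x, y)\<bar> \<le> f x) \<Longrightarrow> u \<in> Linfty_dominated \<eta>"
  unfolding Linfty_dominated_def by blast

lemma Linfty_dominated_bounded: "(\<And>z. \<bar>u z\<bar> \<le> C) \<Longrightarrow> u \<in> Linfty_dominated \<eta>"
  by (rule Linfty_dominatedI[OF Linfty_const[of C]]) simp

interpretation Linfty_dominated: function_space "Linfty_dominated \<eta>" for \<eta> :: "'e measure"
proof
  show "(\<lambda>_. 0) \<in> Linfty_dominated \<eta>" by (rule Linfty_dominated_bounded[of _ 0]) simp
  show "(\<lambda>z. u z + v z) \<in> Linfty_dominated \<eta>"
    if "u \<in> Linfty_dominated \<eta>" "v \<in> Linfty_dominated \<eta>" for u v :: "'e \<times> 's \<Rightarrow> real"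
  proof -
    obtain f g where f: "f \<in> Linfty \<eta>" "\<And>x y. \<bar>u (x, y)\<bar> \<le> f x"
      and g: "g \<in> Linfty \<eta>" "\<And>x y. \<bar>v (x, y)\<bar> \<le> g x"
      using \<open>u \<in> _\<close> \<open>v \<in> _\<close> unfolding Linfty_dominated_def by blast
    show ?thesis
      by (rule Linfty_dominatedI[OF Linfty_add[OF f(1) g(1)]])
        (intro order_trans[OF abs_triangle_ineq] add_mono f g)
  qed
  show "(\<lambda>z. t * u z) \<in> Linfty_dominated \<eta>"
    if "u \<in> Linfty_dominated \<eta>" for u :: "'e \<times> 's \<Rightarrow> real" and t
  proof -
    obtain f where f: "f \<in> Linfty \<eta>" "\<And>x y. \<bar>u (x, y)\<bar> \<le> f x"
      using \<open>u \<in> _\<close> unfolding Linfty_dominated_def by blast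
    show ?thesis
      by (rule Linfty_dominatedI[OF Linfty_scale[OF f(1), of "\<bar>t\<bar>"]])
        (simp add: abs_mult mult_left_mono f)
  qed
qed

text \<open>The last assumption contains positivity, with f = g = 0, and both marginals, since it
  can be applied to f + g and to its negative.\<close>

locale coupling_functional = two_marginals \<eta> \<nu>
  for \<eta> :: "'e::second_countable_topology measure" and \<nu> :: "'s::polish_space measure" +
  fixes L :: "('e \<times> 's \<Rightarrow> real) \<Rightarrow> real"
  assumes L_add: "u \<in> Linfty_dominated \<eta> \<Longrightarrow> v \<in> Linfty_dominated \<eta> \<Longrightarrow>
      L (\<lambda>z. u z + v z) = L u + L v"
    and L_scale: "u \<in> Linfty_dominated \<eta> \<Longrightarrow> L (\<lambda>z. t * u z) = t * L u"
    and L_le: "u \<in> Linfty_dominated \<eta> \<Longrightarrow> f \<in> Linfty \<eta> \<Longrightarrow> g \<in> bcontfun \<Longrightarrow>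
      (\<And>x y. u (x, y) \<le> f x + g y) \<Longrightarrow> L u \<le> (\<integral>x. f x \<partial>completion \<eta>) + (\<integral>y. g y \<partial>\<nu>)"
begin

lemma L_minus: "u \<in> Linfty_dominated \<eta> \<Longrightarrow> L (\<lambda>z. - u z) = - L u"
  using L_scale[of u "-1"] by simp

lemma L_diff:
  "u \<in> Linfty_dominated \<eta> \<Longrightarrow> v \<in> Linfty_dominated \<eta> \<Longrightarrow> L (\<lambda>z. u z - v z) = L u - L v"
  using L_add[of u "\<lambda>z. - v z"] L_minus[of v] Linfty_dominated.minus[of v \<eta>] by simp

lemma diff_dominated:
  "u \<in> Linfty_dominated \<eta> \<Longrightarrow> v \<in> Linfty_dominated \<eta> \<Longrightarrow> (\<lambda>z. u z - v z) \<in> Linfty_dominated \<eta>"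
  using Linfty_dominated.add[of u \<eta> "\<lambda>z. - v z"] Linfty_dominated.minus[of v \<eta>] by simp

lemma L_le_const:
  assumes "u \<in> Linfty_dominated \<eta>" "\<And>z. u z \<le> C" shows "L u \<le> C"
proof -
  have "L u \<le> (\<integral>x. C \<partial>completion \<eta>) + (\<integral>y. 0 \<partial>\<nu>)"
    by (rule L_le[OF assms(1) Linfty_const bcontfun_const_real]) (simp add: assms(2))
  then show ?thesis using E.prob_space by simp
qed

lemma L_mono:
  "u \<in> Linfty_dominated \<eta> \<Longrightarrow> v \<in> Linfty_dominated \<eta> \<Longrightarrow> (\<And>z. u z \<le> v z) \<Longrightarrow> L u \<le> L v"
  using L_le_const[of "\<lambda>z. u z - v z" 0] L_diff[of u v] diff_dominated[of u v] by simp

lemma L_zero: "L (\<lambda>_. 0) = 0"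
  using L_scale[OF Linfty_dominated.zero, of 0] by simp

lemma sum_dominated:
  "(\<And>i. i \<in> I \<Longrightarrow> u i \<in> Linfty_dominated \<eta>) \<Longrightarrow> (\<lambda>z. \<Sum>i\<in>I. u i z) \<in> Linfty_dominated \<eta>"
  by (induction I rule: infinite_finite_induct)
    (auto intro: Linfty_dominated.zero Linfty_dominated.add)

lemma L_sum:
  "(\<And>i. i \<in> I \<Longrightarrow> u i \<in> Linfty_dominated \<eta>) \<Longrightarrow> L (\<lambda>z. \<Sum>i\<in>I. u i z) = (\<Sum>i\<in>I. L (u i))"
  by (induction I rule: infinite_finite_induct) (auto simp: L_zero L_add sum_dominated)

lemma indicator_dominated: "indicator W \<in> Linfty_dominated \<eta>"
  by (rule Linfty_dominated_bounded[of _ 1]) (simp add: indicator_def)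

text \<open>The indicator of a closed set is the decreasing limit of the continuous functions max(0,
  1 - k dist(y, C)), and L is bounded by the integral of each of them. The limit is taken under
  \<nu>, not inside L.\<close>

lemma L_indicator_snd_closed:
  assumes C: "closed C" shows "L (indicator (UNIV \<times> C)) \<le> measure \<nu> C"
\<comment> \<open>The empty set is separate because \<open>infdist\<close> to it is 0 by convention,
  which would make \<open>g k\<close> constantly 1.\<close>
proof (cases "C = {}")
  case True
  have "indicator {} = (\<lambda>_::'e \<times> 's. 0::real)" by (auto simp: indicator_def)
  then show ?thesis using True L_zero by simp
next
  case False
  define g where "g k y = max 0 (1 - real k * infdist y C)" for k y
  have g01: "0 \<le> g k y" "g k y \<le> 1" for k y unfolding g_def by (auto simp: infdist_nonneg)
  have gC: "g k y = 1" if "y \<in> C" for k y unfolding g_def using that by simp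
  have cont: "continuous_on UNIV (g k)" for k unfolding g_def by (intro continuous_intros)
  have gb: "g k \<in> bcontfun" for k
    using cont[of k] g01[of k] unfolding bcontfun_def bounded_iff by (auto intro!: exI[of _ 1])
  have "L (indicator (UNIV \<times> C)) \<le> (\<integral>x. 0 \<partial>completion \<eta>) + (\<integral>y. g k y \<partial>\<nu>)" for k
    by (rule L_le[OF indicator_dominated Linfty_const gb])
      (use gC g01 in \<open>auto simp: indicator_def\<close>)
  moreover have "(\<lambda>k. \<integral>y. g k y \<partial>\<nu>) \<longlonglongrightarrow> (\<integral>y. indicator C y \<partial>\<nu>)"
  proof (rule integral_dominated_convergence[where w="\<lambda>_. 1"])
    show "g k \<in> borel_measurable \<nu>" for k
      by (rule borel_measurable_integrable[OF S.bcontfun_integrable[OF gb]])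
    show "AE y in \<nu>. (\<lambda>k. g k y) \<longlonglongrightarrow> indicator C y"
    proof (rule AE_I2)
      fix y
      show "(\<lambda>k. g k y) \<longlonglongrightarrow> indicator C y"
      proof (cases "y \<in> C")
        case True then show ?thesis by (simp add: gC)
      next
        case y: False
        then have pos: "infdist y C > 0"
          using in_closed_iff_infdist_zero[OF C False, of y] infdist_nonneg[of y C] by linarith
        obtain n :: nat where n: "1 < n * infdist y C" using reals_Archimedean3[OF pos] by blast
        have "g k y = 0" if "k \<ge> n" for k
        proof -
          have "real n * infdist y C \<le> real k * infdist y C" using that pos by (intro mult_right_mono) auto
          then show ?thesis unfolding g_def using n by simp
        qed
        then have "\<forall>\<^sub>F k in sequentially. g k y = 0" unfolding eventually_sequentially by blast
        then show ?thesis using y by (simp add: tendsto_eventually)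
      qed
    qed
    show "AE y in \<nu>. norm (g k y) \<le> 1" for k using g01 by (intro AE_I2) simp
    show "indicator C \<in> borel_measurable \<nu>"
      using C S.sets_eq by (intro borel_measurable_indicator) auto
  qed auto
  ultimately have "L (indicator (UNIV \<times> C)) \<le> (\<integral>y. indicator C y \<partial>\<nu>)"
    by (intro LIMSEQ_le_const) auto
  then show ?thesis using C S.sets_eq by simp
qed

sublocale coupling_content \<eta> \<nu> "\<lambda>W. L (indicator W)"
proof
  show "0 \<le> L (indicator W)" for W
    using L_mono[OF Linfty_dominated.zero indicator_dominated, of W] L_zero by simp
  fix W W' :: "('e \<times> 's) set" assume "W \<inter> W' = {}"
  then have "indicator (W \<union> W') = (\<lambda>z. indicator W z + indicator W' z :: real)"
    by (auto simp: indicator_def fun_eq_iff)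
  then show "L (indicator (W \<union> W')) = L (indicator W) + L (indicator W')"
    by (simp add: L_add indicator_dominated)
next
  fix U :: "'e set" assume U: "U \<in> sets borel"
  have iU: "(\<lambda>x. t * indicator U x) \<in> Linfty \<eta>" for t
    by (rule Linfty_borel[of _ _ "\<bar>t\<bar>"]) (use U E.sets_eq in \<open>auto simp: indicator_def\<close>)
  have int: "(\<integral>x. t * indicator U x \<partial>completion \<eta>) = t * measure \<eta> U" for t
    using U E.sets_eq by simp
  have "t * L (indicator (U \<times> UNIV)) \<le> t * measure \<eta> U" for t
  proof -
    have "L (\<lambda>z. t * indicator (U \<times> UNIV) z)
        \<le> (\<integral>x. t * indicator U x \<partial>completion \<eta>) + (\<integral>y. 0 \<partial>\<nu>)"
      by (rule L_le[OF Linfty_dominated.scale[OF indicator_dominated] iU bcontfun_const_real])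
        (simp add: indicator_def)
    then show ?thesis using int[of t] L_scale[OF indicator_dominated, of t "U \<times> UNIV"] by auto
  qed
  \<comment> \<open>With both signs of t the upper bound becomes an equality.\<close>
  from this[of 1] this[of "-1"] show "L (indicator (U \<times> UNIV)) = measure \<eta> U" by simp
next
  fix V assume V: "V \<in> continuity_sets \<nu>"
  \<comment> \<open>V and its closure have the same \<nu>-measure, so the estimate for closed sets
    suffices.\<close>
  have "L (indicator (UNIV \<times> V)) \<le> L (indicator (UNIV \<times> closure V))"
    using closure_subset[of V]
    by (intro L_mono indicator_dominated) (auto simp: indicator_def)
  also have "\<dots> \<le> measure \<nu> V"
    using L_indicator_snd_closed[of "closure V"] S.measure_closure_continuity_set[OF V] by simp
  finally show "L (indicator (UNIV \<times> V)) \<le> measure \<nu> V" .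
qed

section \<open>Representing L by integrals against the coupling\<close>

context
  fixes \<gamma> :: "('e \<times> 's) measure"
  assumes \<gamma>: "\<gamma> \<in> couplings \<eta> \<nu>" and \<gamma>_L: "\<And>W. W \<in> section_algebra \<eta> \<nu> \<Longrightarrow> measure \<gamma> W = L (indicator W)"
begin

lemma level_sets_measurable:
  assumes "\<And>a. {z. v z < a} \<in> section_algebra \<eta> \<nu>" shows "(v :: 'e \<times> 's \<Rightarrow> real) \<in> borel_measurable \<gamma>"
  unfolding borel_measurable_iff_less
  using assms section_algebra_borel by (simp add: coupling_space[OF \<gamma>] coupling_sets[OF \<gamma>])

text \<open>L and the integral agree on indicators of the algebra, hence on finite combinations of
  them. The function v is within 1/n of such a combination, namely floor(n v)/n, and both
  functionals are contractions for the uniform norm.\<close>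

lemma L_eq_integral:
  fixes v :: "'e \<times> 's \<Rightarrow> real"
  assumes lev: "\<And>a. {z. v z < a} \<in> section_algebra \<eta> \<nu>" and bd: "\<And>z. \<bar>v z\<bar> \<le> K"
  shows "L v = (\<integral>z. v z \<partial>\<gamma>)"
proof -
  interpret G: prob_space \<gamma> by (rule coupling_prob_space[OF \<gamma>])
  have vX: "v \<in> Linfty_dominated \<eta>" by (rule Linfty_dominated_bounded[OF bd])
  have vm: "v \<in> borel_measurable \<gamma>" by (rule level_sets_measurable[OF lev])
  have vi: "integrable \<gamma> v" by (rule G.integrable_const_bound[of v K]) (use bd vm in auto)
  have est: "\<bar>L v - (\<integral>z. v z \<partial>\<gamma>)\<bar> \<le> 2 / n" if n: "n > 0" for n :: nat
  proof -
    define J where "J = {- \<lceil>n * K\<rceil> .. \<lceil>n * K\<rceil>}"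
    \<comment> \<open>S j is the slice where floor(n v) = j; only the finitely many j in J occur,
      since v is bounded by K.\<close>
    define S where "S j = {z. v z < (j + 1) / n} - {z. v z < j / n}" for j :: int
    define w where "w z = (\<Sum>j\<in>J. (j / n) * indicator (S j) z)" for z
    have SA: "S j \<in> section_algebra \<eta> \<nu>" for j unfolding S_def by (intro \<A>.Diff lev)
    have S_iff: "z \<in> S j \<longleftrightarrow> j = \<lfloor>n * v z\<rfloor>" for z j
      unfolding S_def using n by (auto simp: field_simps floor_eq_iff[THEN iffD2] floor_unique) linarith+
    have fl: "\<lfloor>n * v z\<rfloor> \<in> J" for z
    proof -
      have "- (n * K) \<le> n * v z" "n * v z \<le> n * K"
        using mult_left_mono[of "- K" "v z" "real n"] mult_left_mono[of "v z" K "real n"] bd[of z]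
        by (auto simp: abs_le_iff)
      then show ?thesis unfolding J_def by simp linarith
    qed
    have w: "w z = \<lfloor>n * v z\<rfloor> / n" for z
    proof -
      have "w z = (\<Sum>j\<in>J. if j = \<lfloor>n * v z\<rfloor> then j / n else 0)"
        unfolding w_def by (rule sum.cong) (auto simp: S_iff indicator_def)
      then show ?thesis using fl[of z] by (simp add: J_def)
    qed
    have "w z \<le> v z" "v z \<le> w z + 1 / n" for z
      unfolding w using n by (simp_all add: field_simps) linarith
    then have close: "v z - w z \<le> 1 / n" "w z - v z \<le> 1 / n" for z
      by (smt (verit) divide_nonneg_nonneg of_nat_0_le_iff)+
    have wX: "w \<in> Linfty_dominated \<eta>"
      unfolding w_def by (intro sum_dominated Linfty_dominated.scale indicator_dominated)
    have "L w = (\<Sum>j\<in>J. L (\<lambda>z. (j / n) * indicator (S j) z))"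
      unfolding w_def by (intro L_sum Linfty_dominated.scale indicator_dominated)
    then have Lw: "L w = (\<Sum>j\<in>J. (j / n) * L (indicator (S j)))"
      by (simp only: L_scale[OF indicator_dominated])
    have Sm: "S j \<in> sets \<gamma>" for j using section_algebra_borel[OF SA] by (simp add: coupling_sets[OF \<gamma>])
    have wi: "integrable \<gamma> w"
      unfolding w_def using Sm by (intro Bochner_Integration.integrable_sum integrable_mult_right)
        (auto simp: G.emeasure_eq_measure)
    have "(\<integral>z. w z \<partial>\<gamma>) = (\<Sum>j\<in>J. (j / n) * measure \<gamma> (S j))"
      unfolding w_def using Sm by (subst Bochner_Integration.integral_sum) (auto simp: G.emeasure_eq_measure)
    then have eq: "L w = (\<integral>z. w z \<partial>\<gamma>)" unfolding Lw by (simp add: \<gamma>_L SA)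
    have "\<bar>L v - L w\<bar> \<le> 1 / n"
      using L_le_const[OF diff_dominated[OF vX wX] close(1)] L_le_const[OF diff_dominated[OF wX vX] close(2)]
      by (simp add: L_diff vX wX abs_le_iff)
    moreover have "\<bar>(\<integral>z. v z \<partial>\<gamma>) - (\<integral>z. w z \<partial>\<gamma>)\<bar> \<le> 1 / n"
    proof -
      have "(\<integral>z. v z - w z \<partial>\<gamma>) \<le> (\<integral>z. 1 / n \<partial>\<gamma>)" "(\<integral>z. w z - v z \<partial>\<gamma>) \<le> (\<integral>z. 1 / n \<partial>\<gamma>)"
        using close vi wi by (intro integral_mono; simp)+
      then show ?thesis using vi wi by (simp add: G.prob_space abs_le_iff)
    qed
    ultimately show ?thesis using eq by (simp add: abs_le_iff field_simps)
  qed
  have "\<bar>L v - (\<integral>z. v z \<partial>\<gamma>)\<bar> \<le> e" if "e > 0" for e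
  proof -
    have "e / 2 > 0" using that by simp
    then obtain n where "inverse (real (Suc n)) < e / 2" using reals_Archimedean by blast
    then have "2 / real (Suc n) < e" by (simp add: field_simps)
    then show ?thesis using est[of "Suc n"] by linarith
  qed
  then have "\<bar>L v - (\<integral>z. v z \<partial>\<gamma>)\<bar> \<le> 0" by (rule field_le_epsilon) simp
  then show ?thesis by simp
qed

text \<open>Z is only measurable for the completion, so level sets of u need not lie in the algebra.
  Those of a bounded Borel version Z' do, and L does not distinguish the two: the difference is
  dominated by |Z - Z'|, a function of x with integral 0.\<close>

lemma L_tensor_indicator:
  assumes Z: "Z \<in> Linfty \<eta>" and V: "V \<in> continuity_sets \<nu>"
  defines "u \<equiv> \<lambda>z. Z (fst z) * indicator V (snd z)"
  shows "u \<in> Linfty_dominated \<eta>" and "integrable (completion \<gamma>) u"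
    and "L u = (\<integral>z. u z \<partial>completion \<gamma>)"
proof -
  obtain Z' C where Z': "Z' \<in> borel_measurable \<eta>" "\<And>x. \<bar>Z' x\<bar> \<le> C" "AE x in completion \<eta>. Z x = Z' x"
    using Linfty_AE_bounded_borel[OF Z] by metis
  define v where "v = (\<lambda>z. Z' (fst z) * indicator V (snd z) :: real)"
  have Z'L: "Z' \<in> Linfty \<eta>" by (rule Linfty_borel[OF Z'(1,2)])
  have tensor: "(\<lambda>z. f (fst z) * indicator V (snd z)) \<in> Linfty_dominated \<eta>" if "f \<in> Linfty \<eta>" for f
    by (rule Linfty_dominatedI[OF Linfty_abs[OF that]]) (simp add: indicator_def)
  show uX: "u \<in> Linfty_dominated \<eta>" unfolding u_def by (rule tensor[OF Z])
  have vX: "v \<in> Linfty_dominated \<eta>" unfolding v_def by (rule tensor[OF Z'L])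
  have Vm: "(\<lambda>z. indicator V (snd z) :: real) \<in> borel_measurable (completion \<gamma>)"
    by (intro measurable_completion measurable_compose[OF coupling_snd_measurable[OF \<gamma>]]
        borel_measurable_indicator S.continuity_sets_borel[OF V])
  have um: "u \<in> borel_measurable (completion \<gamma>)"
    unfolding u_def using coupling_Linfty_measurable[OF \<gamma> Z] Vm by measurable
  show ui: "integrable (completion \<gamma>) u"
    by (rule Bochner_Integration.integrable_bound[OF coupling_Linfty_integrable[OF \<gamma> Z] um])
      (auto simp: u_def indicator_def)
  have AE_uv: "AE z in completion \<gamma>. u z = v z"
    using coupling_AE_fst[OF \<gamma> Z'(3)] by eventually_elim (simp add: u_def v_def)
  have diffL: "(\<lambda>x. \<bar>Z x - Z' x\<bar>) \<in> Linfty \<eta>"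
    using Linfty_abs[OF Linfty_add[OF Z Linfty_scale[OF Z'L, of "-1"]]] by simp
  have "(\<integral>x. \<bar>Z x - Z' x\<bar> \<partial>completion \<eta>) = (\<integral>x. 0 \<partial>completion \<eta>)"
    using Z'(3) by (intro integral_cong_AE) (use Linfty_measurable[OF diffL] in auto)
  then have int0: "(\<integral>x. \<bar>Z x - Z' x\<bar> \<partial>completion \<eta>) = 0" by simp
  have "L (\<lambda>z. u z - v z) \<le> (\<integral>x. \<bar>Z x - Z' x\<bar> \<partial>completion \<eta>) + (\<integral>y. 0 \<partial>\<nu>)"
    by (rule L_le[OF diff_dominated[OF uX vX] diffL bcontfun_const_real])
      (auto simp: u_def v_def indicator_def abs_if)
  moreover have "L (\<lambda>z. v z - u z) \<le> (\<integral>x. \<bar>Z x - Z' x\<bar> \<partial>completion \<eta>) + (\<integral>y. 0 \<partial>\<nu>)"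
    by (rule L_le[OF diff_dominated[OF vX uX] diffL bcontfun_const_real])
      (auto simp: u_def v_def indicator_def abs_if)
  ultimately have "L u = L v" using int0 by (simp add: L_diff uX vX)
  also have "\<dots> = (\<integral>z. v z \<partial>\<gamma>)"
  proof (rule L_eq_integral)
    show "\<bar>v z\<bar> \<le> max 0 C" for z using Z'(2)[of "fst z"] by (auto simp: v_def indicator_def)
    fix a
    have "{x. Z' x < a} \<in> sets borel"
      using Z'(1) E.sets_eq unfolding borel_measurable_iff_less by simp
    then have 1: "{x. Z' x < a} \<times> V \<in> section_algebra \<eta> \<nu>" by (rule section_algebra_Times[OF _ V])
    \<comment> \<open>Off V the function v vanishes, so the complementary strip belongs to the level
      set exactly when a > 0.\<close>
    have 2: "UNIV \<times> (if 0 < a then - V else {}) \<in> section_algebra \<eta> \<nu>"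
      using S.continuity_sets_Compl[OF V] S.continuity_sets_empty by (intro section_algebra_Times) auto
    have "{z. v z < a} = ({x. Z' x < a} \<times> V) \<union> (UNIV \<times> (if 0 < a then - V else {}))"
      by (auto simp: v_def indicator_def split: if_splits)
    then show "{z. v z < a} \<in> section_algebra \<eta> \<nu>" using \<A>.Un[OF 1 2] by (simp only:)
  qed
  also have "\<dots> = (\<integral>z. v z \<partial>completion \<gamma>)"
  proof (rule integral_completion[symmetric])
    have "fst \<in> \<gamma> \<rightarrow>\<^sub>M \<eta>"
      unfolding measurable_cong_sets[OF refl E.sets_eq] by (rule coupling_fst_measurable[OF \<gamma>])
    then show "v \<in> borel_measurable \<gamma>"
      unfolding v_def using Z'(1) coupling_snd_measurable[OF \<gamma>] S.continuity_sets_borel[OF V] by measurable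
  qed
  also have "\<dots> = (\<integral>z. u z \<partial>completion \<gamma>)"
  proof (rule integral_cong_AE)
    show "v \<in> borel_measurable (completion \<gamma>)"
      unfolding v_def using coupling_Linfty_measurable[OF \<gamma> Z'L] Vm by measurable
    show "AE z in completion \<gamma>. v z = u z" using AE_uv by eventually_elim simp
  qed (rule um)
  finally show "L u = (\<integral>z. u z \<partial>completion \<gamma>)" .
qed

end

end

section \<open>The functional attaining the dual value\<close>

text \<open>The cost of dominating \<open>u\<close> when, besides \<open>f\<close> and \<open>g\<close> at the price of their integrals,
  every \<open>w \<in> \<W>\<close> can be bought at the price \<open>d\<close>. The Hahn--Banach theorem is applied to the
  infimum of these costs.\<close>

definition budgets ::
  "'e measure \<Rightarrow> 's::topological_space measure \<Rightarrow> ('e \<times> 's \<Rightarrow> real) set \<Rightarrow> real \<Rightarrow> ('e \<times> 's \<Rightarrow> real) \<Rightarrow> real set" where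
  "budgets \<eta> \<nu> \<W> d u =
     {(\<integral>x. f x \<partial>completion \<eta>) + (\<integral>y. g y \<partial>\<nu>) + t * d | f g t w.
        f \<in> Linfty \<eta> \<and> g \<in> bcontfun \<and> 0 \<le> t \<and> w \<in> \<W> \<and>
        (\<forall>x y. u (x, y) \<le> f x + g y + t * w (x, y))}"

section \<open>The sublinear cost functional\<close>

context two_marginals
begin

context
  fixes \<W> :: "('e \<times> 's \<Rightarrow> real) set" and d :: real
  assumes ne: "\<W> \<noteq> {}"
    and max: "\<And>v w. v \<in> \<W> \<Longrightarrow> w \<in> \<W> \<Longrightarrow> (\<lambda>z. max (v z) (w z)) \<in> \<W>"
    and dual: "\<And>f g w. f \<in> Linfty \<eta> \<Longrightarrow> g \<in> bcontfun \<Longrightarrow> w \<in> \<W> \<Longrightarrow>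
      (\<And>x y. f x + g y \<le> w (x, y)) \<Longrightarrow> (\<integral>x. f x \<partial>completion \<eta>) + (\<integral>y. g y \<partial>\<nu>) \<le> d"
begin

lemma budgetsI:
  "f \<in> Linfty \<eta> \<Longrightarrow> g \<in> bcontfun \<Longrightarrow> 0 \<le> t \<Longrightarrow> w \<in> \<W> \<Longrightarrow>
   (\<And>x y. u (x, y) \<le> f x + g y + t * w (x, y)) \<Longrightarrow>
   (\<integral>x. f x \<partial>completion \<eta>) + (\<integral>y. g y \<partial>\<nu>) + t * d \<in> budgets \<eta> \<nu> \<W> d u"
  unfolding budgets_def by blast

lemma Linfty_integral:
  "f \<in> Linfty \<eta> \<Longrightarrow> integrable (completion \<eta>) f"
  by (rule Linfty_integrable[OF E.prob_space_axioms])

text \<open>For t > 0 this is the bound on the dual problem, scaled by t. The case t = 0 is settled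
  by integration instead: f(x) + g(y) \<le> 0 is integrated in x for fixed y and then in y.\<close>

lemma dual_scaled:
  assumes f: "f \<in> Linfty \<eta>" and g: "g \<in> bcontfun" and w: "w \<in> \<W>" and t: "0 \<le> t"
    and le: "\<And>x y. f x + g y \<le> t * w (x, y)"
  shows "(\<integral>x. f x \<partial>completion \<eta>) + (\<integral>y. g y \<partial>\<nu>) \<le> t * d"
proof -
  have pos: "(\<integral>x. f x \<partial>completion \<eta>) + (\<integral>y. g y \<partial>\<nu>) \<le> s * d"
    if s: "0 < s" and le: "\<And>x y. f x + g y \<le> s * w (x, y)"
      and f: "f \<in> Linfty \<eta>" and g: "g \<in> bcontfun" for s f g
  proof -
    have "(\<integral>x. inverse s * f x \<partial>completion \<eta>) + (\<integral>y. inverse s * g y \<partial>\<nu>) \<le> d"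
      using le s
      by (intro dual[OF Linfty_scale[OF f] bcontfun_scale_real[OF g] w]) (simp add: field_simps)
    then show ?thesis using s by (simp add: field_simps)
  qed
  show ?thesis
  proof (cases "t = 0")
    case False
    then show ?thesis using pos[OF _ le f g] t by simp
  next
    case True
    have "(\<integral>x. f x \<partial>completion \<eta>) + g y \<le> 0" for y
    proof -
      have "(\<integral>x. f x + g y \<partial>completion \<eta>) \<le> (\<integral>x. 0 \<partial>completion \<eta>)"
        using le Linfty_integral[OF f] Linfty_integral[OF Linfty_const] True
        by (intro integral_mono) auto
      then show ?thesis using Linfty_integral[OF f] Linfty_integral[OF Linfty_const] E.prob_space by simp
    qed
    then have "(\<integral>y. (\<integral>x. f x \<partial>completion \<eta>) + g y \<partial>\<nu>) \<le> (\<integral>y. 0 \<partial>\<nu>)"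
      using S.bcontfun_integrable[OF g] by (intro integral_mono) auto
    then show ?thesis using S.bcontfun_integrable[OF g] S.prob_space True by simp
  qed
qed

text \<open>This is where the bound d on the dual problem enters. If u is dominated at cost a, the
  pair (-f0 - f, -g) lies below t w, so its integrals add up to at most t d.\<close>

lemma budgets_lower:
  assumes f0: "f0 \<in> Linfty \<eta>" and u: "\<And>x y. \<bar>u (x, y)\<bar> \<le> f0 x" and a: "a \<in> budgets \<eta> \<nu> \<W> d u"
  shows "- (\<integral>x. f0 x \<partial>completion \<eta>) \<le> a"
proof -
  obtain f g t w where *: "a = (\<integral>x. f x \<partial>completion \<eta>) + (\<integral>y. g y \<partial>\<nu>) + t * d"
    "f \<in> Linfty \<eta>" "g \<in> bcontfun" "0 \<le> t" "w \<in> \<W>"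
    "\<And>x y. u (x, y) \<le> f x + g y + t * w (x, y)"
    using a unfolding budgets_def by blast
  have "(\<integral>x. - 1 * f0 x + - 1 * f x \<partial>completion \<eta>) + (\<integral>y. - 1 * g y \<partial>\<nu>) \<le> t * d"
  proof (rule dual_scaled[OF Linfty_add[OF Linfty_scale[OF f0] Linfty_scale[OF *(2)]]
        bcontfun_scale_real[OF *(3)] *(5) *(4)])
    show "- 1 * f0 x + - 1 * f x + - 1 * g y \<le> t * w (x, y)" for x y
      using *(6)[of x y] u[of x y] by linarith
  qed
  then show ?thesis
    using *(1) Linfty_integral[OF f0] Linfty_integral[OF *(2)] by simp
qed

lemma budgets_ne: "u \<in> Linfty_dominated \<eta> \<Longrightarrow> budgets \<eta> \<nu> \<W> d u \<noteq> {}"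
proof -
  assume "u \<in> Linfty_dominated \<eta>"
  then obtain f where f: "f \<in> Linfty \<eta>" "\<And>x y. \<bar>u (x, y)\<bar> \<le> f x"
    unfolding Linfty_dominated_def by blast
  obtain w where w: "w \<in> \<W>" using ne by blast
  have "u (x, y) \<le> f x + 0 + 0 * w (x, y)" for x y using f(2)[of x y] by simp
  from budgetsI[OF f(1) bcontfun_const_real _ w this] show ?thesis by auto
qed

lemma budgets_bdd:
  assumes "u \<in> Linfty_dominated \<eta>" shows "bdd_below (budgets \<eta> \<nu> \<W> d u)"
proof -
  obtain f where f: "f \<in> Linfty \<eta>" "\<And>x y. \<bar>u (x, y)\<bar> \<le> f x"
    using assms unfolding Linfty_dominated_def by blast
  show ?thesis by (rule bdd_belowI[OF budgets_lower[OF f]])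
qed

text \<open>Two purchases t w and t' w' are merged into t + t' units of the pointwise maximum of w
  and w', which is again in \<open>\<W>\<close>.\<close>

lemma budgets_add:
  assumes "a \<in> budgets \<eta> \<nu> \<W> d u" "b \<in> budgets \<eta> \<nu> \<W> d v"
  shows "a + b \<in> budgets \<eta> \<nu> \<W> d (\<lambda>z. u z + v z)"
proof -
  obtain f g t w where 1: "a = (\<integral>x. f x \<partial>completion \<eta>) + (\<integral>y. g y \<partial>\<nu>) + t * d"
    "f \<in> Linfty \<eta>" "g \<in> bcontfun" "0 \<le> t" "w \<in> \<W>"
    "\<And>x y. u (x, y) \<le> f x + g y + t * w (x, y)"
    using assms(1) unfolding budgets_def by blast
  obtain f' g' t' w' where 2: "b = (\<integral>x. f' x \<partial>completion \<eta>) + (\<integral>y. g' y \<partial>\<nu>) + t' * d"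
    "f' \<in> Linfty \<eta>" "g' \<in> bcontfun" "0 \<le> t'" "w' \<in> \<W>"
    "\<And>x y. v (x, y) \<le> f' x + g' y + t' * w' (x, y)"
    using assms(2) unfolding budgets_def by blast
  have "(\<integral>x. f x + f' x \<partial>completion \<eta>) + (\<integral>y. g y + g' y \<partial>\<nu>) + (t + t') * d
      \<in> budgets \<eta> \<nu> \<W> d (\<lambda>z. u z + v z)"
  proof (rule budgetsI[OF Linfty_add[OF 1(2) 2(2)] bcontfun_add_real[OF 1(3) 2(3)] _ max[OF 1(5) 2(5)]])
    show "u (x, y) + v (x, y) \<le> (f x + f' x) + (g y + g' y) + (t + t') * max (w (x, y)) (w' (x, y))" for x y
    proof -
      have "t * w (x, y) \<le> t * max (w (x, y)) (w' (x, y))" "t' * w' (x, y) \<le> t' * max (w (x, y)) (w' (x, y))"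
        using 1(4) 2(4) by (auto intro: mult_left_mono)
      then show ?thesis using 1(6)[of x y] 2(6)[of x y] by (simp only: distrib_right)
    qed
  qed (use 1 2 in auto)
  also have "(\<integral>x. f x + f' x \<partial>completion \<eta>) + (\<integral>y. g y + g' y \<partial>\<nu>) + (t + t') * d = a + b"
    using 1 2 Linfty_integral S.bcontfun_integrable by (simp add: distrib_right)
  finally show ?thesis .
qed

lemma budgets_scale:
  assumes "a \<in> budgets \<eta> \<nu> \<W> d u" and s: "s > 0"
  shows "s * a \<in> budgets \<eta> \<nu> \<W> d (\<lambda>z. s * u z)"
proof -
  obtain f g t w where 1: "a = (\<integral>x. f x \<partial>completion \<eta>) + (\<integral>y. g y \<partial>\<nu>) + t * d"
    "f \<in> Linfty \<eta>" "g \<in> bcontfun" "0 \<le> t" "w \<in> \<W>"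
    "\<And>x y. u (x, y) \<le> f x + g y + t * w (x, y)"
    using assms(1) unfolding budgets_def by blast
  have "(\<integral>x. s * f x \<partial>completion \<eta>) + (\<integral>y. s * g y \<partial>\<nu>) + (s * t) * d
      \<in> budgets \<eta> \<nu> \<W> d (\<lambda>z. s * u z)"
  proof (rule budgetsI[OF Linfty_scale[OF 1(2)] bcontfun_scale_real[OF 1(3)] _ 1(5)])
    show "s * u (x, y) \<le> s * f x + s * g y + s * t * w (x, y)" for x y
      using mult_left_mono[OF 1(6)[of x y], of s] s by (simp add: algebra_simps)
  qed (use 1 s in auto)
  then show ?thesis using 1(1) by (simp add: algebra_simps)
qed

lemma sublinear_budget: "sublinear_on (Linfty_dominated \<eta>) (\<lambda>u. Inf (budgets \<eta> \<nu> \<W> d u))"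
  (is "sublinear_on ?X ?q")
  unfolding sublinear_on_def
proof (intro conjI ballI allI impI)
  fix u v assume u: "u \<in> ?X" and v: "v \<in> ?X"
  have "?q (\<lambda>z. u z + v z) \<le> a + b" if "a \<in> budgets \<eta> \<nu> \<W> d u" "b \<in> budgets \<eta> \<nu> \<W> d v" for a b
    by (intro cInf_lower budgets_add budgets_bdd Linfty_dominated.add u v that)
  then have "?q (\<lambda>z. u z + v z) - b \<le> ?q u" if "b \<in> budgets \<eta> \<nu> \<W> d v" for b
    using that by (intro cInf_greatest budgets_ne u) (simp add: diff_le_eq)
  then have "?q (\<lambda>z. u z + v z) - ?q u \<le> ?q v"
    by (intro cInf_greatest budgets_ne v) (simp add: algebra_simps)
  then show "?q (\<lambda>z. u z + v z) \<le> ?q u + ?q v" by simp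
next
  have le: "?q (\<lambda>z. s * u z) \<le> s * ?q u" if u: "u \<in> ?X" and s: "s > 0" for u and s :: real
  proof -
    have "?q (\<lambda>z. s * u z) / s \<le> a" if "a \<in> budgets \<eta> \<nu> \<W> d u" for a
      using cInf_lower[OF budgets_scale[OF that s] budgets_bdd[OF Linfty_dominated.scale[OF u]]] s
      by (simp add: pos_divide_le_eq mult.commute)
    then have "?q (\<lambda>z. s * u z) / s \<le> ?q u" by (intro cInf_greatest budgets_ne u)
    then show ?thesis using s by (simp add: pos_divide_le_eq mult.commute)
  qed
  fix u and t :: real assume u: "u \<in> ?X" and t: "t > 0"
  have "?q (\<lambda>z. inverse t * (t * u z)) \<le> inverse t * ?q (\<lambda>z. t * u z)"
    using t by (intro le Linfty_dominated.scale u) auto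
  then have "t * ?q u \<le> ?q (\<lambda>z. t * u z)" using t by (simp add: field_simps)
  then show "?q (\<lambda>z. t * u z) = t * ?q u" using le[OF u t] by simp
qed

text \<open>The two properties of L come from two kinds of budget: t = 0 gives the bound by the
  integrals of f and g, while f = g = 0 with t = 1 prices w itself at d.\<close>

theorem dual_optimal_functional:
  obtains L where "coupling_functional \<eta> \<nu> L" "\<And>w. w \<in> \<W> \<Longrightarrow> w \<in> Linfty_dominated \<eta> \<Longrightarrow> L w \<le> d"
proof -
  obtain L :: "('e \<times> 's \<Rightarrow> real) \<Rightarrow> real" where L: "\<And>u v. u \<in> Linfty_dominated \<eta> \<Longrightarrow> v \<in> Linfty_dominated \<eta> \<Longrightarrow> L (\<lambda>z. u z + v z) = L u + L v"
    "\<And>u t. u \<in> Linfty_dominated \<eta> \<Longrightarrow> L (\<lambda>z. t * u z) = t * L u"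
    "\<And>u. u \<in> Linfty_dominated \<eta> \<Longrightarrow> L u \<le> Inf (budgets \<eta> \<nu> \<W> d u)"
    by (rule Linfty_dominated.hahn_banach[OF sublinear_budget]) (rule that)
  have L_budget: "L u \<le> a" if "u \<in> Linfty_dominated \<eta>" "a \<in> budgets \<eta> \<nu> \<W> d u" for u a
    using L(3)[OF that(1)] cInf_lower[OF that(2) budgets_bdd[OF that(1)]] by linarith
  have "coupling_functional \<eta> \<nu> L"
  proof (intro coupling_functional.intro coupling_functional_axioms.intro two_marginals_axioms L(1,2))
    fix u :: "'e \<times> 's \<Rightarrow> real" and f g assume u: "u \<in> Linfty_dominated \<eta>" and fg: "f \<in> Linfty \<eta>" "g \<in> bcontfun"
      and le: "\<And>x y. u (x, y) \<le> f x + g y"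
    obtain w where w: "w \<in> \<W>" using ne by blast
    have "u (x, y) \<le> f x + g y + 0 * w (x, y)" for x y using le[of x y] by simp
    from L_budget[OF u budgetsI[OF fg _ w this]]
    show "L u \<le> (\<integral>x. f x \<partial>completion \<eta>) + (\<integral>y. g y \<partial>\<nu>)" by simp
  qed
  moreover have "L w \<le> d" if w: "w \<in> \<W>" "w \<in> Linfty_dominated \<eta>" for w
  proof -
    have "w (x, y) \<le> 0 + 0 + 1 * w (x, y)" for x y by simp
    from L_budget[OF w(2) budgetsI[OF Linfty_const bcontfun_const_real _ w(1) this]]
    show ?thesis by simp
  qed
  ultimately show thesis using that by blast
qed

end

text \<open>Here c is the supremum of the step functions with value q on b and 0 elsewhere, where q
  is a nonnegative rational, b a basic open set and q \<le> c on b. There are countably many of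
  them, and s n is the maximum of the first n + 1 in an enumeration; its level sets are finite
  intersections of algebra sets.\<close>

lemma lower_semicontinuous_approx:
  fixes c :: "'e \<times> 's \<Rightarrow> ereal"
  assumes nonneg: "\<And>z. 0 \<le> c z" and lsc: "lower_semicontinuous c"
  obtains s :: "nat \<Rightarrow> 'e \<times> 's \<Rightarrow> real"
  where "\<And>n z. 0 \<le> s n z" "\<And>n. \<exists>K. \<forall>z. s n z \<le> K" "incseq s"
    "\<And>n a. {z. s n z < a} \<in> section_algebra \<eta> \<nu>" "\<And>n z. ereal (s n z) \<le> c z"
    "\<And>z. c z \<le> (SUP n. ereal (s n z))"
proof -
  obtain B where B: "countable B" "topological_basis B" "\<And>b. b \<in> B \<Longrightarrow> b \<in> section_algebra \<eta> \<nu>"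
    by (rule open_continuity_basis) (rule that)
  define \<K> where "\<K> = {(q, b). q \<in> \<rat> \<and> 0 \<le> q \<and> b \<in> insert {} B \<and> (\<forall>z\<in>b. ereal q \<le> c z)}"
  have "countable \<K>"
  proof (rule countable_subset)
    show "\<K> \<subseteq> \<rat> \<times> insert {} B" unfolding \<K>_def by auto
    show "countable (\<rat> \<times> insert {} B)" using B(1) countable_rat by auto
  qed
  moreover have "(0, {}) \<in> \<K>" unfolding \<K>_def by auto
  ultimately have range: "range (from_nat_into \<K>) = \<K>" by (intro range_from_nat_into) auto
  define e where "e = from_nat_into \<K>"
  define k where "k i z = fst (e i) * indicator (snd (e i)) z" for i z
  define s where "s n z = Max ((\<lambda>i. k i z) ` {..n})" for n z
  have eK: "fst (e i) \<ge> 0" "snd (e i) \<in> section_algebra \<eta> \<nu>" "\<And>z. z \<in> snd (e i) \<Longrightarrow> ereal (fst (e i)) \<le> c z" for i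
  proof -
    have "e i \<in> \<K>" using range unfolding e_def by blast
    then show "fst (e i) \<ge> 0" "snd (e i) \<in> section_algebra \<eta> \<nu>" "\<And>z. z \<in> snd (e i) \<Longrightarrow> ereal (fst (e i)) \<le> c z"
      unfolding \<K>_def using B(3) by (auto split: prod.splits)
  qed
  have k0: "0 \<le> k i z" for i z unfolding k_def using eK(1) by simp
  have kc: "ereal (k i z) \<le> c z" for i z
    unfolding k_def using eK(3)[of z i] nonneg[of z] by (cases "z \<in> snd (e i)") (auto simp: zero_ereal_def)
  have k_le: "k i z \<le> fst (e i)" for i z unfolding k_def using eK(1) by (simp add: indicator_def)
  have klev: "{z. k i z < a} \<in> section_algebra \<eta> \<nu>" for i a
  proof -
    have "{z. k i z < a} = (if 0 < a then (if fst (e i) < a then UNIV else UNIV - snd (e i)) else {})"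
      using eK(1)[of i] unfolding k_def by (auto simp: indicator_def split: if_splits)
    then show ?thesis using eK(2)[of i] by (simp add: \<A>.compl_sets)
  qed
  have ks: "k i z \<le> s n z" if "i \<le> n" for i n z unfolding s_def using that by (intro Max_ge) auto
  show thesis
  proof
    show s0: "0 \<le> s n z" for n z using ks[of 0 n z] k0[of 0 z] by simp
    have "s n z \<le> (\<Sum>i\<le>n. fst (e i))" for n z
    proof -
      have "k i z \<le> (\<Sum>i\<le>n. fst (e i))" if "i \<le> n" for i
        using k_le[of i z] member_le_sum[of i "{..n}" "\<lambda>i. fst (e i)"] that eK(1) by fastforce
      then show ?thesis unfolding s_def by auto
    qed
    then show "\<exists>K. \<forall>z. s n z \<le> K" for n by blast
    show "incseq s" unfolding incseq_def le_fun_def s_def by (auto intro!: Max_mono)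
    show "ereal (s n z) \<le> c z" for n z
    proof -
      have "s n z \<in> (\<lambda>i. k i z) ` {..n}" unfolding s_def by (intro Max_in) auto
      then obtain i where "s n z = k i z" by auto
      then show ?thesis by (simp only: kc)
    qed
    show "{z. s n z < a} \<in> section_algebra \<eta> \<nu>" for n a
    proof -
      have "{z. s n z < a} = (\<Inter>i\<in>{..n}. {z. k i z < a})" unfolding s_def by auto
      then show ?thesis using \<A>.finite_INT[of "{..n}" "\<lambda>i. {z. k i z < a}"] klev by auto
    qed
    show "c z \<le> (SUP n. ereal (s n z))" for z
    proof (rule dense_le)
      fix x assume "x < c z"
      then obtain r :: rat where r: "x < ereal (real_of_rat r)" "ereal (real_of_rat r) < c z"
        using ereal_dense3 by blast
      have "\<exists>n. x \<le> ereal (s n z)"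
      proof (cases "0 \<le> real_of_rat r")
        case False
        then have "x \<le> 0" using r(1) by (metis ereal_less_eq(3) less_imp_le not_le order_trans zero_ereal_def)
        then show ?thesis using s0[of 0 z] by (metis ereal_less_eq(5) order_trans)
      next
        case True
        have "open {z. ereal (real_of_rat r) < c z}" using lsc unfolding lower_semicontinuous_def by blast
        then obtain b where b: "b \<in> B" "z \<in> b" "b \<subseteq> {z. ereal (real_of_rat r) < c z}"
          using topological_basisE[OF B(2)] r(2) by (metis mem_Collect_eq)
        have "(real_of_rat r, b) \<in> \<K>"
          unfolding \<K>_def using True b by (auto intro: less_imp_le)
        then obtain i where "e i = (real_of_rat r, b)" using range unfolding e_def by (metis imageE)
        then have "real_of_rat r = k i z" unfolding k_def using b(2) by simp
        also have "\<dots> \<le> s i z" by (rule ks) simp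
        finally show ?thesis using r(1) by (meson ereal_less_eq(3) less_imp_le order_trans)
      qed
      then show "x \<le> (SUP n. ereal (s n z))" by (meson SUP_upper2 UNIV_I)
    qed
  qed
qed

end

section \<open>Strong duality\<close>

lemma lower_semicontinuous_borel:
  assumes "lower_semicontinuous c" shows "c \<in> borel_measurable borel"
  by (rule borel_measurableI_greater) (use assms in \<open>auto simp: lower_semicontinuous_def\<close>)

text \<open>Monotone convergence bounds the integral of c by a finite number, so c is finite almost
  everywhere and the extended integral of c + h reduces to a sum of ordinary integrals.\<close>

lemma ereal_integral_le_of_approx:
  fixes c :: "'a \<Rightarrow> ereal" and s :: "nat \<Rightarrow> 'a \<Rightarrow> real"
  assumes s: "\<And>n. integrable M (s n)" "\<And>n z. 0 \<le> s n z" "incseq s"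
    and c: "c \<in> borel_measurable M" "\<And>z. 0 \<le> c z" "\<And>z. c z \<le> (SUP n. ereal (s n z))"
    and h: "integrable (completion M) h"
    and le: "\<And>n. (\<integral>z. s n z \<partial>M) + (\<integral>z. h z \<partial>completion M) \<le> d"
  shows "ereal_integral (completion M) (\<lambda>z. c z + ereal (h z)) \<le> ereal d"
proof -
  define b where "b = d - (\<integral>z. h z \<partial>completion M)"
  have sb: "(\<integral>z. s n z \<partial>M) \<le> b" for n using le[of n] by (simp add: b_def)
  have b0: "0 \<le> b" using order_trans[OF Bochner_Integration.integral_nonneg sb[of 0]] s(2) by simp
  have csup: "e2ennreal (c z) \<le> (SUP n. ennreal (s n z))" for z
  proof -
    have "ereal (s n z) \<le> enn2ereal (SUP n. ennreal (s n z))" for n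
    proof -
      have "enn2ereal (ennreal (s n z)) \<le> enn2ereal (SUP n. ennreal (s n z))"
        unfolding less_eq_ennreal.rep_eq[symmetric] by (intro SUP_upper UNIV_I)
      then show ?thesis using s(2)[of n z] by simp
    qed
    then have "(SUP n. ereal (s n z)) \<le> enn2ereal (SUP n. ennreal (s n z))" by (intro SUP_least)
    with c(3)[of z] have "c z \<le> enn2ereal (SUP n. ennreal (s n z))" by (rule order_trans)
    then have "e2ennreal (c z) \<le> e2ennreal (enn2ereal (SUP n. ennreal (s n z)))" by (rule e2ennreal_mono)
    then show ?thesis by simp
  qed
  have "(\<integral>\<^sup>+ z. e2ennreal (c z) \<partial>M) \<le> (\<integral>\<^sup>+ z. (SUP n. ennreal (s n z)) \<partial>M)"
    by (intro nn_integral_mono csup)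
  also have "\<dots> = (SUP n. (\<integral>\<^sup>+ z. ennreal (s n z) \<partial>M))"
    using s by (intro nn_integral_monotone_convergence_SUP)
      (auto simp: incseq_def le_fun_def intro!: ennreal_leI)
  also have "\<dots> \<le> ennreal b"
    using s sb by (intro SUP_least) (simp add: nn_integral_eq_integral ennreal_leI)
  finally have cb: "(\<integral>\<^sup>+ z. e2ennreal (c z) \<partial>M) \<le> ennreal b" .
  \<comment> \<open>\<open>real_of_ereal\<close> turns the value \<infinity> into 0; this changes c
    only on the null set where it is infinite.\<close>
  define r where "r z = real_of_ereal (c z)" for z
  have cm: "(\<lambda>z. e2ennreal (c z)) \<in> borel_measurable M" using c(1) by measurable
  have "(\<integral>\<^sup>+ z. e2ennreal (c z) \<partial>M) \<noteq> \<infinity>" using cb by (auto simp: top_unique)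
  then have "AE z in M. e2ennreal (c z) \<noteq> \<infinity>" by (rule nn_integral_PInf_AE[OF cm])
  then have AE_c: "AE z in M. c z = ereal (r z)"
  proof eventually_elim
    case (elim z)
    then have "c z \<noteq> \<infinity>" by (auto simp: e2ennreal_infty)
    then show ?case using c(2)[of z] unfolding r_def by (cases "c z") auto
  qed
  have r0: "0 \<le> r z" for z unfolding r_def using c(2) by (simp add: real_of_ereal_pos)
  have rm: "r \<in> borel_measurable M" unfolding r_def using c(1) by measurable
  have eq: "(\<integral>\<^sup>+ z. ennreal (r z) \<partial>M) = (\<integral>\<^sup>+ z. e2ennreal (c z) \<partial>M)"
    using AE_c by (intro nn_integral_cong_AE) (auto simp: e2ennreal_ereal)
  have ri: "integrable M r"
    using rm r0 cb eq by (intro integrableI_nonneg) (auto simp: le_less_trans)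
  have "ennreal (\<integral>z. r z \<partial>M) \<le> ennreal b"
    using cb eq nn_integral_eq_integral[OF ri] r0 by simp
  then have rb: "(\<integral>z. r z \<partial>M) \<le> b" using b0 by (simp add: ennreal_le_iff)
  have ri': "integrable (completion M) r" using ri rm by (simp add: integrable_completion)
  have "ereal_integral (completion M) (\<lambda>z. c z + ereal (h z)) = ereal (\<integral>z. r z + h z \<partial>completion M)"
  proof (rule ereal_integral_eq)
    show "integrable (completion M) (\<lambda>z. r z + h z)" using ri' h by simp
    show "AE z in completion M. c z + ereal (h z) = ereal (r z + h z)"
      using AE_completion[OF AE_c] by eventually_elim simp
  qed
  also have "(\<integral>z. r z + h z \<partial>completion M) = (\<integral>z. r z \<partial>M) + (\<integral>z. h z \<partial>completion M)"
    using ri' h integral_completion[OF rm] by simp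
  also have "\<dots> \<le> d" using rb by (simp add: b_def)
  finally show ?thesis by simp
qed

lemma (in two_marginals) strong_duality:
  fixes c :: "'e \<times> 's \<Rightarrow> ereal" and h :: "'e \<times> 's \<Rightarrow> real"
  assumes c: "\<And>z. 0 \<le> c z" "lower_semicontinuous c"
    and I: "finite I" and Z: "\<And>i. i \<in> I \<Longrightarrow> Z i \<in> Linfty \<eta>"
    and A: "\<And>i. i \<in> I \<Longrightarrow> A i \<in> continuity_sets \<nu>"
    and h: "\<And>x y. h (x, y) = (\<Sum>i\<in>I. Z i x * indicator (A i) y)"
    and d: "dual_value c h \<eta> \<nu> \<le> ereal d"
  shows "primal_value c h \<eta> \<nu> \<le> ereal d"
proof -
  \<comment> \<open>All real minorants of c + h. A pair (f, g) below such a minorant is feasible for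
    the dual problem, and h itself is a minorant because c is nonnegative.\<close>
  define \<W> where "\<W> = {w. \<forall>z. ereal (w z) \<le> c z + ereal (h z)}"
  have hW: "h \<in> \<W>"
    unfolding \<W>_def using c(1) add_right_mono[of 0] by fastforce
  have max: "(\<lambda>z. max (v z) (w z)) \<in> \<W>" if "v \<in> \<W>" "w \<in> \<W>" for v w
    using that unfolding \<W>_def by (auto simp: max_def)
  have dual: "(\<integral>x. f x \<partial>completion \<eta>) + (\<integral>y. g y \<partial>\<nu>) \<le> d"
    if "f \<in> Linfty \<eta>" "g \<in> bcontfun" "w \<in> \<W>" "\<And>x y. f x + g y \<le> w (x, y)" for f g w
  proof -
    have "ereal (f x + g y) \<le> c (x, y) + ereal (h (x, y))" for x y
    proof -
      have "ereal (f x + g y) \<le> ereal (w (x, y))" using that(4) by simp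
      also have "\<dots> \<le> c (x, y) + ereal (h (x, y))" using that(3) unfolding \<W>_def by blast
      finally show ?thesis .
    qed
    then have "ereal ((\<integral>x. f x \<partial>completion \<eta>) + (\<integral>y. g y \<partial>\<nu>)) \<le> dual_value c h \<eta> \<nu>"
      unfolding dual_value_def using that(1,2) by (intro Sup_upper) blast
    with d have "ereal ((\<integral>x. f x \<partial>completion \<eta>) + (\<integral>y. g y \<partial>\<nu>)) \<le> ereal d" by (rule order_trans[rotated])
    then show ?thesis by simp
  qed
  obtain L where L: "coupling_functional \<eta> \<nu> L"
    and L_le_d: "\<And>w. w \<in> \<W> \<Longrightarrow> w \<in> Linfty_dominated \<eta> \<Longrightarrow> L w \<le> d"
  proof (rule dual_optimal_functional[of \<W> d])
    show "\<W> \<noteq> {}" using hW by blast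
  qed (use max dual in blast)+
  interpret L: coupling_functional \<eta> \<nu> L by (rule L)
  obtain \<gamma> where \<gamma>: "\<gamma> \<in> couplings \<eta> \<nu>" "\<And>W. W \<in> section_algebra \<eta> \<nu> \<Longrightarrow> measure \<gamma> W = L (indicator W)"
    by (rule L.extension_to_coupling) (rule that)
  interpret G: prob_space \<gamma> by (rule coupling_prob_space[OF \<gamma>(1)])
  have h': "h = (\<lambda>z. \<Sum>i\<in>I. Z i (fst z) * indicator (A i) (snd z))" using h by (simp add: fun_eq_iff)
  note tensor = L.L_tensor_indicator[OF \<gamma> Z A]
  have hX: "h \<in> Linfty_dominated \<eta>" unfolding h' by (rule L.sum_dominated) (rule tensor(1))
  have hi: "integrable (completion \<gamma>) h"
    unfolding h' by (rule Bochner_Integration.integrable_sum) (rule tensor(2))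
  have "L h = (\<Sum>i\<in>I. \<integral>z. Z i (fst z) * indicator (A i) (snd z) \<partial>completion \<gamma>)"
    unfolding h' by (subst L.L_sum) (auto intro!: sum.cong tensor)
  also have "\<dots> = (\<integral>z. h z \<partial>completion \<gamma>)"
    unfolding h' by (rule Bochner_Integration.integral_sum[symmetric]) (rule tensor(2))
  finally have Lh: "L h = (\<integral>z. h z \<partial>completion \<gamma>)" .
  obtain s where s: "\<And>n z. 0 \<le> s n z" "\<And>n. \<exists>K. \<forall>z. s n z \<le> K" "incseq s"
    "\<And>n a. {z. s n z < a} \<in> section_algebra \<eta> \<nu>" "\<And>n z. ereal (s n z) \<le> c z"
    "\<And>z. c z \<le> (SUP n. ereal (s n z))"
    by (rule lower_semicontinuous_approx[OF c]) (rule that)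
  have bd: "\<exists>K. \<forall>z. \<bar>s n z\<bar> \<le> K" for n using s(1,2) by (metis abs_of_nonneg)
  have sX: "s n \<in> Linfty_dominated \<eta>" for n
  proof -
    obtain K where "\<forall>z. \<bar>s n z\<bar> \<le> K" using bd by blast
    then show ?thesis by (intro Linfty_dominated_bounded[of _ K]) blast
  qed
  have sm: "s n \<in> borel_measurable \<gamma>" for n by (rule L.level_sets_measurable[OF \<gamma> s(4)])
  have si: "integrable \<gamma> (s n)" for n
  proof -
    obtain K where "\<forall>z. \<bar>s n z\<bar> \<le> K" using bd by blast
    then show ?thesis by (intro G.integrable_const_bound[of "s n" K] sm AE_I2) (simp only: real_norm_def)
  qed
  have Ls: "L (s n) = (\<integral>z. s n z \<partial>\<gamma>)" for n
  proof -
    obtain K where "\<forall>z. \<bar>s n z\<bar> \<le> K" using bd by blast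
    then have K: "\<bar>s n z\<bar> \<le> K" for z by (rule spec)
    show ?thesis by (rule L.L_eq_integral[OF \<gamma> s(4) K])
  qed
  \<comment> \<open>The price bound reaches c only through its minorants: s n + h lies in the domain
    of L even if c is unbounded or infinite, since s n is bounded.\<close>
  have "(\<lambda>z. s n z + h z) \<in> \<W>" for n
    unfolding \<W>_def using add_right_mono[OF s(5)[of n]] by (simp flip: plus_ereal.simps(1))
  then have "L (\<lambda>z. s n z + h z) \<le> d" for n
    by (rule L_le_d[OF _ Linfty_dominated.add[OF sX hX]])
  then have "(\<integral>z. s n z \<partial>\<gamma>) + (\<integral>z. h z \<partial>completion \<gamma>) \<le> d" for n
    by (simp add: L.L_add sX hX Ls Lh)
  moreover have "c \<in> borel_measurable \<gamma>"
    unfolding measurable_cong_sets[OF coupling_sets[OF \<gamma>(1)] refl]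
    by (rule lower_semicontinuous_borel[OF c(2)])
  ultimately have "ereal_integral (completion \<gamma>) (\<lambda>z. c z + ereal (h z)) \<le> ereal d"
    by (intro ereal_integral_le_of_approx[OF si s(1) s(3) _ c(1) s(6) hi])
  then show ?thesis
    unfolding primal_value_def using \<gamma>(1) by (intro Inf_lower2) auto
qed

theorem lemma3:
  fixes c :: "'e::polish_space \<times> 's::polish_space \<Rightarrow> ereal"
    and \<eta> :: "'e measure" and \<nu> :: "'s measure"
    and h :: "'e \<times> 's \<Rightarrow> real"
    and N :: nat and Z :: "nat \<Rightarrow> 'e \<Rightarrow> real" and A :: "nat \<Rightarrow> 's set"
  assumes "\<And>z. 0 \<le> c z"
    and "lower_semicontinuous c"
    and "\<eta> \<in> borel_probs" and "\<nu> \<in> borel_probs"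
    and "\<And>i. i \<in> {1..N} \<Longrightarrow> Z i \<in> Linfty \<eta>"
    and "\<And>i. i \<in> {1..N} \<Longrightarrow> A i \<in> sets borel"
    and "\<And>i. i \<in> {1..N} \<Longrightarrow> measure \<nu> (frontier (A i)) = 0"
    and "\<And>x y. h (x, y) = (\<Sum>i=1..N. Z i x * indicator (A i) y)"
  shows "primal_value c h \<eta> \<nu> = dual_value c h \<eta> \<nu>"
proof (rule antisym)
  show "dual_value c h \<eta> \<nu> \<le> primal_value c h \<eta> \<nu>" by (rule weak_duality)
  interpret two_marginals \<eta> \<nu>
    using assms(3,4)
    by (intro two_marginals.intro polish_prob.intro metric_borel_prob.intro borel_prob.intro
        borel_prob_axioms.intro) (auto simp: borel_probs_def)
  have A: "\<And>i. i \<in> {1..N} \<Longrightarrow> A i \<in> continuity_sets \<nu>"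
    using assms(6,7) by (simp add: continuity_sets_def)
  show "primal_value c h \<eta> \<nu> \<le> dual_value c h \<eta> \<nu>"
  \<comment> \<open>Only a finite dual value calls for the construction; the value \<infinity>
    leaves nothing to prove.\<close>
  proof (cases "dual_value c h \<eta> \<nu>")
    case (real d)
    then show ?thesis
      using strong_duality[OF assms(1,2) _ assms(5) A assms(8), of d] by simp
  next
    case MInf
    \<comment> \<open>The dual value is never -\<infinity>: since c is nonnegative, this f together
      with g = 0 is feasible.\<close>
    let ?f = "\<lambda>x. - 1 * (\<Sum>i=1..N. \<bar>Z i x\<bar>)"
    have "?f \<in> Linfty \<eta>"
      by (intro Linfty_scale Linfty_sum Linfty_abs assms(5))
    moreover have "ereal (?f x + 0) \<le> c (x, y) + ereal (h (x, y))" for x y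
    proof -
      have "\<bar>h (x, y)\<bar> \<le> (\<Sum>i=1..N. \<bar>Z i x\<bar>)"
        unfolding assms(8) by (intro order_trans[OF sum_abs] sum_mono) (simp add: indicator_def)
      then have "ereal (?f x + 0) \<le> 0 + ereal (h (x, y))" by simp
      also have "\<dots> \<le> c (x, y) + ereal (h (x, y))" by (intro add_right_mono assms(1))
      finally show ?thesis .
    qed
    ultimately have "ereal ((\<integral>x. ?f x \<partial>completion \<eta>) + (\<integral>y. 0 \<partial>\<nu>)) \<le> dual_value c h \<eta> \<nu>"
      unfolding dual_value_def using bcontfun_const_real[of 0] by (intro Sup_upper) blast
    then show ?thesis using MInf by simp
  qed simp
qed

end
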